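(* Let $x(t)$ be a cyclostationary signal, and let the lag vector $\boldsymbol{\tau}=[\tau_1\dots\tau_n]^T$, the order $n$ and the number of conjugations $q$ be fixed. Let $$x_{\text{lag s/h}}(t,\boldsymbol{\tau})_{n,q}=\prod_{i=1}^n x_{i\,\text{s/h}}^{( * )_i}(t,\tau_i),\qquad x_{i\,\text{s/h}}(t,\tau_i)=x(t-\tau_i)\left[\sum_{m=-\infty}^{\infty}p_{\text{s/h}}(t-mT_s)\right],$$ be the uniformly sampled (sample-and-hold) lag product and $$x_{\text{lag ncs}}(t,\boldsymbol{\tau})_{n,q}=\prod_{i=1}^n x_{i\,\text{ncs}}^{( * )_i}(t,\tau_i),\qquad x_{i\,\text{ncs}}(t,\tau_i)=x(t-\tau_i)\left[\sum_{m=-\infty}^{\infty}a_m\,p_{\text{s/h}}(t-mT_s)\right],$$ the nonuniformly sampled (zeroed-out sample-and-hold) lag product, and let $$R_{x_{\text{s/h}}}(t,\boldsymbol{\tau})_{n,q}=\hat{E}\left[x_{\text{lag s/h}}(t,\boldsymbol{\tau})_{n,q}\right],\qquad R_{x_{\text{ncs}}}(t,\boldsymbol{\tau})_{n,q}=\hat{E}\left[x_{\text{lag ncs}}(t,\boldsymbol{\tau})_{n,q}\right]$$ be the corresponding time-varying $n$th order moments. Then the time-varying $n$th order moments obtained using the nonuniformly sampled lag product signal satisfy $$R_{x_{\text{ncs}}}(t,\boldsymbol{\tau})_{n,q}=\gamma\,R_{x_{\text{s/h}}}(t,\boldsymbol{\tau})_{n,q}.$$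
   Context: The setting is the fraction-of-time (FOT) probability framework, in which statistical functions are defined from a single realization of an infinite-duration signal. $\hat{E}$ is the multiple sine-wave extraction operator, the FOT analogue of expectation: for a time series $f$, $\hat{E}[f(u)](t)=\sum_{\alpha\in A(f)}\langle f(u)e^{-j2\pi\alpha u}\rangle_u\,e^{j2\pi\alpha t}$, where $\langle\cdot\rangle_u$ denotes time averaging with respect to $u$ and $A(f)$ is the set of $\alpha\in\mathbb{R}$ with $\langle f(u)e^{-j2\pi\alpha u}\rangle_u\neq0$, assumed countable for the time series considered. In the definitions of the moments, $\hat{E}$ acts on the lag product as a function of time and the result is evaluated at $t$. The symbol $( * )_i$ denotes optional complex conjugation of the $i$th factor; $q$ is the total number of conjugations, and the first $q$ factors are the conjugated ones. $T_s$ is the sampling interval (bounded by the Nyquist sampling interval), and $p_{\text{s/h}}(t)=\mathrm{rect}(t/\upsilon)$ is the sample-and-hold pulse, of duration $\upsilon\ll T_s$, so that the pulses do not overlap. The sampling indicators $a_m$ are i.i.d. Bernoulli random variables with $\mathbb{P}[a_m=1]=\gamma$ and $\mathbb{P}[a_m=0]=1-\gamma$ for a constant $\gamma\in(0,1]$, so that $\mathbb{E}[a_m^k]=\gamma$ for every positive integer $k$. In the FOT sense, $a_m$ is thought of as taking the value 1 with FOT probability $\gamma$ and the value 0 with FOT probability $1-\gamma$. The same $a_m$ are used in all $n$ factors (a common nonuniform clock). *)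

theory Defs
  imports "HOL-Probability.Probability"
begin

section \<open>Time averages and sine-wave extraction\<close>

definition time_avg_upto :: "(real \<Rightarrow> complex) \<Rightarrow> real \<Rightarrow> complex" where
  "time_avg_upto f T = (LBINT u:{- T / 2..T / 2}. f u) / complex_of_real T"

definition time_avg :: "(real \<Rightarrow> complex) \<Rightarrow> complex" where
  "time_avg f = Lim at_top (time_avg_upto f)"

definition demodulate :: "(real \<Rightarrow> complex) \<Rightarrow> real \<Rightarrow> real \<Rightarrow> complex" where
  "demodulate f \<alpha> u = f u * cis (- 2 * pi * \<alpha> * u)"

definition sine_coeff :: "(real \<Rightarrow> complex) \<Rightarrow> real \<Rightarrow> complex" where
  "sine_coeff f \<alpha> = time_avg (demodulate f \<alpha>)"

definition cycle_freqs :: "(real \<Rightarrow> complex) \<Rightarrow> real set" where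
  "cycle_freqs f = {\<alpha>. sine_coeff f \<alpha> \<noteq> 0}"

text \<open>
  \<open>Lim\<close> and the Lebesgue integral are total; the following predicate says that all time averages
  entering the sine-wave extraction of \<open>f\<close> exist and that there are countably many sine waves.
\<close>

definition sine_extractable :: "(real \<Rightarrow> complex) \<Rightarrow> bool" where
  "sine_extractable f \<longleftrightarrow>
     (\<forall>T. set_integrable lborel {- T..T} f) \<and>
     (\<forall>\<alpha>. \<exists>c. (time_avg_upto (demodulate f \<alpha>) \<longlongrightarrow> c) at_top) \<and>
     countable (cycle_freqs f)"

text \<open>
  The series over \<open>cycle_freqs f\<close> is summed symmetrically, as the limit of its restrictions to the
  bands \<open>\<bar>\<alpha>\<bar> \<le> B\<close>. Unconditional summation over all of \<open>cycle_freqs f\<close> would be too strict: the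
  Fourier coefficients of a train of rectangular pulses decay only like \<open>1 / k\<close>. Inside a band,
  where the frequencies of an almost-periodic signal may accumulate, the sum is unconditional.
\<close>

definition sine_wave :: "(real \<Rightarrow> complex) \<Rightarrow> real \<Rightarrow> real \<Rightarrow> complex" where
  "sine_wave f t \<alpha> = sine_coeff f \<alpha> * cis (2 * pi * \<alpha> * t)"

definition sine_waves_sum :: "(real \<Rightarrow> complex) \<Rightarrow> real \<Rightarrow> complex \<Rightarrow> bool" where
  "sine_waves_sum f t s \<longleftrightarrow>
     (\<forall>B. sine_wave f t summable_on {\<alpha> \<in> cycle_freqs f. \<bar>\<alpha>\<bar> \<le> B}) \<and>
     ((\<lambda>B. \<Sum>\<^sub>\<infinity>\<alpha>\<in>{\<alpha> \<in> cycle_freqs f. \<bar>\<alpha>\<bar> \<le> B}. sine_wave f t \<alpha>) \<longlongrightarrow> s) at_top"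

definition extraction_converges :: "(real \<Rightarrow> complex) \<Rightarrow> real \<Rightarrow> bool" where
  "extraction_converges f t \<longleftrightarrow> (\<exists>s. sine_waves_sum f t s)"

text \<open>The value is \<open>0\<close> by convention at those \<open>t\<close> where the series diverges.\<close>

definition E_hat :: "(real \<Rightarrow> complex) \<Rightarrow> real \<Rightarrow> complex" where
  "E_hat f t = (if extraction_converges f t then THE s. sine_waves_sum f t s else 0)"

section \<open>Lag products and cyclostationarity\<close>

definition opt_conj :: "bool \<Rightarrow> complex \<Rightarrow> complex" where
  "opt_conj b z = (if b then cnj z else z)"

text \<open>\<open>y t s\<close> is the factor at time \<open>t\<close> with lag \<open>s\<close>; only the lags \<open>\<tau> 1, \<dots>, \<tau> n\<close> matter.\<close>

definition lag_product ::
  "nat \<Rightarrow> nat \<Rightarrow> (real \<Rightarrow> real \<Rightarrow> complex) \<Rightarrow> (nat \<Rightarrow> real) \<Rightarrow> real \<Rightarrow> complex" where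
  "lag_product n q y \<tau> t = (\<Prod>i = 1..n. opt_conj (i \<le> q) (y t (\<tau> i)))"

definition delayed :: "(real \<Rightarrow> complex) \<Rightarrow> real \<Rightarrow> real \<Rightarrow> complex" where
  "delayed x t s = x (t - s)"

text \<open>
  Cyclostationarity in the fraction-of-time sense: the lag products of every order have a
  sine-wave decomposition, and some lag product contains a sine wave of nonzero frequency.
\<close>

definition cyclostationary :: "(real \<Rightarrow> complex) \<Rightarrow> bool" where
  "cyclostationary x \<longleftrightarrow>
     x \<in> borel_measurable borel \<and>
     (\<forall>n q \<tau>. 1 \<le> n \<and> q \<le> n \<longrightarrow> sine_extractable (lag_product n q (delayed x) \<tau>)) \<and>
     (\<exists>n q \<tau> \<alpha>. 1 \<le> n \<and> q \<le> n \<and> \<alpha> \<noteq> 0 \<and> \<alpha> \<in> cycle_freqs (lag_product n q (delayed x) \<tau>))"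

section \<open>Sampling\<close>

definition rect :: "real \<Rightarrow> real" where
  "rect t = (if \<bar>t\<bar> \<le> 1 / 2 then 1 else 0)"

definition p_sh :: "real \<Rightarrow> real \<Rightarrow> real" where
  "p_sh \<upsilon> t = rect (t / \<upsilon>)"

definition x_sh :: "(real \<Rightarrow> complex) \<Rightarrow> real \<Rightarrow> real \<Rightarrow> real \<Rightarrow> real \<Rightarrow> complex" where
  "x_sh x Ts \<upsilon> t s =
     x (t - s) * complex_of_real (\<Sum>\<^sub>\<infinity>m\<in>(UNIV :: int set). p_sh \<upsilon> (t - of_int m * Ts))"

definition x_ncs ::
  "(real \<Rightarrow> complex) \<Rightarrow> (int \<Rightarrow> real) \<Rightarrow> real \<Rightarrow> real \<Rightarrow> real \<Rightarrow> real \<Rightarrow> complex" where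
  "x_ncs x a Ts \<upsilon> t s =
     x (t - s) * complex_of_real (\<Sum>\<^sub>\<infinity>m\<in>(UNIV :: int set). a m * p_sh \<upsilon> (t - of_int m * Ts))"

definition x_lag_sh ::
  "(real \<Rightarrow> complex) \<Rightarrow> real \<Rightarrow> real \<Rightarrow> nat \<Rightarrow> nat \<Rightarrow> (nat \<Rightarrow> real) \<Rightarrow> real \<Rightarrow> complex" where
  "x_lag_sh x Ts \<upsilon> n q \<tau> = lag_product n q (x_sh x Ts \<upsilon>) \<tau>"

definition x_lag_ncs ::
  "(real \<Rightarrow> complex) \<Rightarrow> (int \<Rightarrow> real) \<Rightarrow> real \<Rightarrow> real \<Rightarrow> nat \<Rightarrow> nat \<Rightarrow> (nat \<Rightarrow> real) \<Rightarrow>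
     real \<Rightarrow> complex" where
  "x_lag_ncs x a Ts \<upsilon> n q \<tau> = lag_product n q (x_ncs x a Ts \<upsilon>) \<tau>"

definition R_sh ::
  "(real \<Rightarrow> complex) \<Rightarrow> real \<Rightarrow> real \<Rightarrow> nat \<Rightarrow> nat \<Rightarrow> (nat \<Rightarrow> real) \<Rightarrow> real \<Rightarrow> complex" where
  "R_sh x Ts \<upsilon> n q \<tau> t = E_hat (x_lag_sh x Ts \<upsilon> n q \<tau>) t"

definition R_ncs ::
  "(real \<Rightarrow> complex) \<Rightarrow> (int \<Rightarrow> real) \<Rightarrow> real \<Rightarrow> real \<Rightarrow> nat \<Rightarrow> nat \<Rightarrow> (nat \<Rightarrow> real) \<Rightarrow>
     real \<Rightarrow> complex" where
  "R_ncs x a Ts \<upsilon> n q \<tau> t = E_hat (x_lag_ncs x a Ts \<upsilon> n q \<tau>) t"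

definition iid_bernoulli :: "'w measure \<Rightarrow> real \<Rightarrow> (int \<Rightarrow> 'w \<Rightarrow> real) \<Rightarrow> bool" where
  "iid_bernoulli M \<gamma> a \<longleftrightarrow>
     prob_space.indep_vars M (\<lambda>_. borel) a UNIV \<and>
     (\<forall>m. measure M {\<omega> \<in> space M. a m \<omega> = 1} = \<gamma> \<and>
          measure M {\<omega> \<in> space M. a m \<omega> = 0} = 1 - \<gamma>)"

end

theory Submission
  imports Defs
begin

text \<open>
  Write \<open>f\<close> for the lag product of \<open>x\<close>. As the pulses do not overlap, sampling multiplies \<open>f\<close> by the
  pulse train \<open>P\<close>, and nonuniform sampling multiplies it by \<open>\<gamma> P\<close> plus the noise train with the
  centred weights \<open>a\<^sub>m - \<gamma>\<close>. Both \<open>|f|\<^sup>2\<close> and \<open>|f|\<^sup>4\<close> are again lag products of \<open>x\<close> (of orders \<open>2n\<close>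
  and \<open>4n\<close>), so they have time averages.

  The bound on \<open>|f|\<^sup>2\<close> lets one replace \<open>P\<close> by polynomials in \<open>cos (2 \<pi> t / T\<^sub>s)\<close>, which only shift cycle
  frequencies by multiples of \<open>1 / T\<^sub>s\<close>; hence the sine-wave coefficients of \<open>f P\<close> exist and only
  countably many are nonzero.

  The noise must almost surely have zero coefficients at all frequencies at once. A van der Corput
  type bound controls the fourth power of a modulated sum by its correlations, independently of
  the frequency, and the correlations of independent centred weights are small in mean square. With
  the bound on \<open>|f|\<^sup>4\<close>, the resulting energies are summable along windows of about \<open>k\<^sup>2\<close> blocks, and
  the growth of the mean of \<open>1 + |f|\<^sup>2\<close> fills in the intermediate window lengths. So every
  coefficient of the nonuniformly sampled product is \<open>\<gamma>\<close> times that of the uniformly sampled one.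
\<close>

section \<open>Scaling of the extraction and sampled lag products\<close>

lemma sine_coeffI:
  assumes "(time_avg_upto (demodulate f \<alpha>) \<longlongrightarrow> c) at_top"
  shows "sine_coeff f \<alpha> = c"
  unfolding sine_coeff_def time_avg_def using assms by (intro tendsto_Lim) auto

text \<open>For nonzero \<open>c\<close> the coefficients of \<open>f\<close> and \<open>g\<close>
  vanish at the same frequencies, so both series run over the same bands and differ by the factor
  \<open>c\<close> in every term.\<close>

lemma sine_waves_sum_scale:
  fixes c :: complex
  assumes coeff: "\<And>\<alpha>. sine_coeff g \<alpha> = c * sine_coeff f \<alpha>" and "c \<noteq> 0"
  shows "sine_waves_sum g t (c * s) \<longleftrightarrow> sine_waves_sum f t s"
proof -
  have freqs: "cycle_freqs g = cycle_freqs f"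
    using assms by (simp add: cycle_freqs_def)
  have wave: "sine_wave g t = (\<lambda>\<alpha>. c * sine_wave f t \<alpha>)"
    by (auto simp: sine_wave_def coeff)
  have lim: "((\<lambda>B. c * F B) \<longlongrightarrow> c * s) at_top \<longleftrightarrow> (F \<longlongrightarrow> s) at_top"
    for F :: "real \<Rightarrow> complex"
    using \<open>c \<noteq> 0\<close> by (rule tendsto_mult_left_iff)
  show ?thesis
    using \<open>c \<noteq> 0\<close>
    by (simp add: sine_waves_sum_def freqs wave infsum_cmult_right' summable_on_cmult_right' lim)
qed

lemma sine_waves_sum_unique:
  assumes "sine_waves_sum f t s" "sine_waves_sum f t s'"
  shows "s = s'"
  using assms unfolding sine_waves_sum_def
  by (intro tendsto_unique[of at_top]) auto

lemma E_hat_eqI: "sine_waves_sum f t s \<Longrightarrow> E_hat f t = s"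
  unfolding E_hat_def extraction_converges_def
  using sine_waves_sum_unique by (auto intro!: the_equality)

text \<open>Convergence transfers in both directions, so the default value 0 of \<open>E_hat\<close>
  is taken by \<open>f\<close> and \<open>g\<close> at the same \<open>t\<close> and is compatible
  with the factor \<open>c\<close>.\<close>

lemma
  fixes c :: complex
  assumes coeff: "\<And>\<alpha>. sine_coeff g \<alpha> = c * sine_coeff f \<alpha>" and "c \<noteq> 0"
  shows extraction_converges_scale: "extraction_converges g t \<longleftrightarrow> extraction_converges f t"
    and E_hat_scale: "E_hat g t = c * E_hat f t"
proof -
  have rev: "sine_waves_sum f t (s / c)" if "sine_waves_sum g t s" for s
    using sine_waves_sum_scale[OF assms, of t "s / c"] that \<open>c \<noteq> 0\<close> by simp
  show conv: "extraction_converges g t \<longleftrightarrow> extraction_converges f t"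
    using rev sine_waves_sum_scale[OF assms, of t] unfolding extraction_converges_def by blast
  show "E_hat g t = c * E_hat f t"
  proof (cases "extraction_converges f t")
    case True
    then obtain s where "sine_waves_sum f t s"
      unfolding extraction_converges_def by blast
    then show ?thesis
      using E_hat_eqI sine_waves_sum_scale[OF assms, of t s] by metis
  next
    case False
    then show ?thesis
      using conv by (simp add: E_hat_def)
  qed
qed

text \<open>The first \<open>n\<close> factors are conjugated and the next \<open>n\<close> repeat
  the same lags unconjugated, so they pair up to squared moduli; conjugation preserves the modulus,
  hence any \<open>q\<close> is covered. Applied repeatedly, this yields time averages of even
  powers of a lag product.\<close>

lemma lag_product_norm_square:
  shows "\<exists>\<tau>'. lag_product (2 * n) n (delayed x) \<tau>' =
    (\<lambda>t. complex_of_real ((norm (lag_product n q (delayed x) \<tau> t))\<^sup>2))"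
proof (intro exI ext)
  fix t
  let ?\<tau>' = "\<lambda>i. if i \<le> n then \<tau> i else \<tau> (i - n)"
  have split: "(\<Prod>i = 1..2 * n. F i) = (\<Prod>i = 1..n. F i) * (\<Prod>i = 1..n. F (i + n))"
    for F :: "nat \<Rightarrow> complex"
  proof -
    have "(\<Prod>i = 1..2 * n. F i) = (\<Prod>i\<in>{1..n} \<union> {n + 1..n + n}. F i)"
      by (intro prod.cong) auto
    also have "\<dots> = (\<Prod>i = 1..n. F i) * (\<Prod>i = 1 + n..n + n. F i)"
      by (subst prod.union_disjoint) (auto simp: add.commute)
    also have "(\<Prod>i = 1 + n..n + n. F i) = (\<Prod>i = 1..n. F (i + n))"
      by (rule prod.shift_bounds_cl_nat_ivl)
    finally show ?thesis .
  qed
  have "lag_product (2 * n) n (delayed x) ?\<tau>' t = (\<Prod>i = 1..n. cnj (x (t - \<tau> i)) * x (t - \<tau> i))"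
    unfolding lag_product_def split by (simp add: delayed_def opt_conj_def prod.distrib)
  also have "\<dots> = (\<Prod>i = 1..n. complex_of_real ((norm (opt_conj (i \<le> q) (delayed x t (\<tau> i))))\<^sup>2))"
    by (intro prod.cong refl)
      (simp add: opt_conj_def delayed_def mult.commute[of "cnj _"] flip: complex_norm_square)
  also have "\<dots> = complex_of_real ((norm (lag_product n q (delayed x) \<tau> t))\<^sup>2)"
    by (simp add: lag_product_def flip: prod_norm prod_power_distrib)
  finally show "lag_product (2 * n) n (delayed x) ?\<tau>' t = \<dots>" .
qed

lemma lag_product_measurable:
  assumes [measurable]: "x \<in> borel_measurable borel"
  shows "lag_product n q (delayed x) \<tau> \<in> borel_measurable borel"
proof -
  have [measurable]: "opt_conj b \<in> borel_measurable borel" for b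
    by (cases b)
      (auto simp: opt_conj_def[abs_def] intro!: borel_measurable_continuous_onI continuous_intros)
  show ?thesis
    unfolding lag_product_def[abs_def] delayed_def by measurable
qed

section \<open>Sampling as multiplication by a pulse train\<close>

definition sampler :: "(int \<Rightarrow> real) \<Rightarrow> real \<Rightarrow> real \<Rightarrow> real \<Rightarrow> real" where
  "sampler b Ts \<upsilon> t =
     b \<lfloor>t / Ts + 1 / 2\<rfloor> * p_sh \<upsilon> (t - of_int \<lfloor>t / Ts + 1 / 2\<rfloor> * Ts)"

lemma p_sh_altdef: "0 < \<upsilon> \<Longrightarrow> p_sh \<upsilon> t = (if \<bar>t\<bar> \<le> \<upsilon> / 2 then 1 else 0)"
  by (simp add: p_sh_def rect_def field_simps)

text \<open>Since \<open>\<upsilon> < Ts\<close>, a nonzero pulse \<open>m\<close> forces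
  \<open>t\<close> to lie strictly within \<open>Ts / 2\<close> of \<open>m * Ts\<close>, so
  \<open>m\<close> is the nearest index \<open>\<lfloor>t / Ts + 1 / 2\<rfloor>\<close> and the
  infinite sum has at most one nonzero term.\<close>

lemma pulse_train_eq_sampler:
  assumes "0 < \<upsilon>" "\<upsilon> < Ts"
  shows "(\<Sum>\<^sub>\<infinity>m\<in>(UNIV :: int set). b m * p_sh \<upsilon> (t - of_int m * Ts)) = sampler b Ts \<upsilon> t"
proof -
  have "p_sh \<upsilon> (t - of_int m * Ts) = 0" if "m \<noteq> \<lfloor>t / Ts + 1 / 2\<rfloor>" for m
  proof (rule ccontr)
    assume "p_sh \<upsilon> (t - of_int m * Ts) \<noteq> 0"
    then have "\<bar>t - of_int m * Ts\<bar> < Ts / 2"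
      using assms by (auto simp: p_sh_altdef split: if_splits)
    then have "of_int m \<le> t / Ts + 1 / 2" "t / Ts + 1 / 2 < of_int m + 1"
      using assms by (auto simp: field_simps abs_if split: if_splits)
    then show False
      using that by (metis floor_unique)
  qed
  then show ?thesis
    unfolding sampler_def
    by (subst infsum_cong_neutral[where T = "{\<lfloor>t / Ts + 1 / 2\<rfloor>}" and g = "\<lambda>m. b m * p_sh \<upsilon> (t - of_int m * Ts)"])
      auto
qed

text \<open>The common clock contributes the same sampler value once per lag. With weights 0 and 1
  this value is real and idempotent, so conjugation fixes it and its \<open>n\<close>-th power
  collapses, using \<open>1 \<le> n\<close>.\<close>

lemma x_lag_ncs_eq:
  assumes "0 < \<upsilon>" "\<upsilon> < Ts" "1 \<le> n" and b: "\<And>m. b m = 0 \<or> b m = 1"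
  shows "x_lag_ncs x b Ts \<upsilon> n q \<tau> =
    (\<lambda>t. lag_product n q (delayed x) \<tau> t * complex_of_real (sampler b Ts \<upsilon> t))"
proof
  fix t
  have "sampler b Ts \<upsilon> t = 0 \<or> sampler b Ts \<upsilon> t = 1"
    using b assms(1) by (auto simp: sampler_def p_sh_altdef)
  then have pow: "sampler b Ts \<upsilon> t ^ n = sampler b Ts \<upsilon> t"
    using \<open>1 \<le> n\<close> by auto
  have "opt_conj c (x_ncs x b Ts \<upsilon> t s) = opt_conj c (delayed x t s) * sampler b Ts \<upsilon> t" for c s
    unfolding x_ncs_def pulse_train_eq_sampler[OF assms(1,2)]
    by (simp add: opt_conj_def delayed_def)
  then show "x_lag_ncs x b Ts \<upsilon> n q \<tau> t =
      lag_product n q (delayed x) \<tau> t * complex_of_real (sampler b Ts \<upsilon> t)"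
    by (simp add: x_lag_ncs_def lag_product_def prod.distrib pow flip: of_real_power)
qed

lemma x_lag_sh_eq_ncs: "x_lag_sh x Ts \<upsilon> n q \<tau> = x_lag_ncs x (\<lambda>_. 1) Ts \<upsilon> n q \<tau>"
  by (simp add: x_lag_sh_def x_lag_ncs_def x_sh_def[abs_def] x_ncs_def[abs_def])

lemma sampler_measurable [measurable]: "sampler b Ts \<upsilon> \<in> borel_measurable borel"
  unfolding sampler_def[abs_def] p_sh_def rect_def by measurable

lemma sampler_bound: "(\<And>m. \<bar>b m\<bar> \<le> 1) \<Longrightarrow> \<bar>sampler b Ts \<upsilon> t\<bar> \<le> 1"
  by (simp add: sampler_def p_sh_def rect_def)

lemma sampler_diff:
  "sampler b Ts \<upsilon> t - c * sampler (\<lambda>_. 1) Ts \<upsilon> t = sampler (\<lambda>m. b m - c) Ts \<upsilon> t"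
  by (simp add: sampler_def algebra_simps)

section \<open>Local integrability and time averages\<close>

definition loc_integrable :: "(real \<Rightarrow> 'a :: {banach, second_countable_topology}) \<Rightarrow> bool" where
  "loc_integrable g \<longleftrightarrow> g \<in> borel_measurable borel \<and> (\<forall>T. set_integrable lborel {- T..T} g)"

lemma loc_integrable_measurable: "loc_integrable g \<Longrightarrow> g \<in> borel_measurable borel"
  by (simp add: loc_integrable_def)

lemma loc_integrable_subset:
  assumes g: "loc_integrable g" and A: "A \<in> sets borel" "A \<subseteq> {- T..T}"
  shows "set_integrable lborel A g"
  using g A unfolding loc_integrable_def by (intro set_integrable_subset[of lborel "{- T..T}" g A]) auto

lemma loc_integrableD:
  assumes "loc_integrable g"
  shows "set_integrable lborel {a..b} g" "set_integrable lborel {a..<b} g"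
  by (auto intro!: loc_integrable_subset[OF assms, of _ "max \<bar>a\<bar> \<bar>b\<bar>"])

lemma loc_integrable_bound:
  assumes f: "loc_integrable f" and g: "g \<in> borel_measurable borel"
    and le: "\<And>u. norm (g u) \<le> norm (f u)"
  shows "loc_integrable g"
  unfolding loc_integrable_def
proof (intro conjI allI g)
  fix T
  show "set_integrable lborel {- T..T} g"
    using f g le unfolding loc_integrable_def
    by (intro set_integrable_bound[of lborel "{- T..T}" f g])
      (auto simp: set_borel_measurable_def)
qed

lemma loc_integrable_add:
  "loc_integrable f \<Longrightarrow> loc_integrable g \<Longrightarrow> loc_integrable (\<lambda>u. f u + g u)"
  by (auto simp: loc_integrable_def)

lemma loc_integrable_diff:
  "loc_integrable f \<Longrightarrow> loc_integrable g \<Longrightarrow> loc_integrable (\<lambda>u. f u - g u)"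
  by (auto simp: loc_integrable_def)

lemma loc_integrable_cmult:
  fixes c :: "'a :: {real_normed_field, banach, second_countable_topology}"
  shows "loc_integrable g \<Longrightarrow> loc_integrable (\<lambda>u. c * g u)"
  by (auto simp: loc_integrable_def)

lemma loc_integrable_norm: "loc_integrable g \<Longrightarrow> loc_integrable (\<lambda>u. norm (g u))"
  by (rule loc_integrable_bound[of "g"]) (auto dest: loc_integrable_measurable)

lemma loc_integrable_const: "loc_integrable (\<lambda>_. c)"
  unfolding loc_integrable_def set_integrable_def
  by (intro conjI allI integrable_scaleR_left integrable_real_indicator)
    (auto simp: emeasure_lborel_Icc_eq)

lemma loc_integrable_bounded_mult:
  fixes f g :: "real \<Rightarrow> 'a :: {real_normed_field, banach, second_countable_topology}"
  assumes "loc_integrable g" "f \<in> borel_measurable borel" "\<And>u. norm (f u) \<le> B"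
  shows "loc_integrable (\<lambda>u. f u * g u)"
proof (rule loc_integrable_bound[of "\<lambda>u. of_real B * g u"])
  show "loc_integrable (\<lambda>u. of_real B * g u)"
    by (rule loc_integrable_cmult) fact
  show "(\<lambda>u. f u * g u) \<in> borel_measurable borel"
    using assms(2) loc_integrable_measurable[OF assms(1)] by measurable
  show "norm (f u * g u) \<le> norm (of_real B * g u)" for u
    using assms(3)[of u] by (auto simp: norm_mult intro!: mult_right_mono)
qed

section \<open>Means over symmetric windows\<close>

definition mean_upto :: "(real \<Rightarrow> real) \<Rightarrow> real \<Rightarrow> real" where
  "mean_upto h T = (LBINT u:{- T / 2..T / 2}. h u) / T"

lemma mean_upto_mono:
  assumes "loc_integrable g" "loc_integrable h" "\<And>u. g u \<le> h u" "0 < T"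
  shows "mean_upto g T \<le> mean_upto h T"
  unfolding mean_upto_def using assms
  by (intro divide_right_mono set_integral_mono loc_integrableD) auto

lemma mean_upto_add:
  assumes "loc_integrable g" "loc_integrable h"
  shows "mean_upto (\<lambda>u. g u + h u) T = mean_upto g T + mean_upto h T"
  unfolding mean_upto_def using loc_integrableD(1)[OF assms(1)] loc_integrableD(1)[OF assms(2)]
  by (simp add: add_divide_distrib)

lemma mean_upto_cmult: "mean_upto (\<lambda>u. c * h u) T = c * mean_upto h T"
  unfolding mean_upto_def by simp

lemma mean_upto_const: "0 < T \<Longrightarrow> mean_upto (\<lambda>_. c) T = c"
  by (simp add: mean_upto_def set_lebesgue_integral_def)

lemma time_avg_upto_add:
  assumes "loc_integrable g" "loc_integrable h"
  shows "time_avg_upto (\<lambda>u. g u + h u) T = time_avg_upto g T + time_avg_upto h T"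
  unfolding time_avg_upto_def
  using loc_integrableD(1)[OF assms(1)] loc_integrableD(1)[OF assms(2)]
  by (simp add: add_divide_distrib)

lemma time_avg_upto_diff:
  assumes "loc_integrable g" "loc_integrable h"
  shows "time_avg_upto (\<lambda>u. g u - h u) T = time_avg_upto g T - time_avg_upto h T"
  unfolding time_avg_upto_def
  using loc_integrableD(1)[OF assms(1)] loc_integrableD(1)[OF assms(2)]
  by (simp add: diff_divide_distrib)

lemma time_avg_upto_cmult: "time_avg_upto (\<lambda>u. c * h u) T = c * time_avg_upto h T"
  unfolding time_avg_upto_def by simp

lemma norm_time_avg_upto_le:
  assumes "loc_integrable g" "0 < T"
  shows "norm (time_avg_upto g T) \<le> mean_upto (\<lambda>u. norm (g u)) T"
  unfolding time_avg_upto_def mean_upto_def using assms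
  by (auto simp: norm_divide intro!: divide_right_mono set_integral_norm_bound loc_integrableD)

section \<open>Demodulation and sine-wave coefficients confined to a frequency set\<close>

lemma norm_demodulate [simp]: "norm (demodulate f \<alpha> u) = norm (f u)"
  by (simp add: demodulate_def norm_mult)

lemma cis_measurable [measurable]: "(\<lambda>u. cis (c * u)) \<in> borel_measurable borel"
  by (intro borel_measurable_continuous_onI continuous_intros)

lemma loc_integrable_demodulate:
  assumes "loc_integrable f"
  shows "loc_integrable (demodulate f \<alpha>)"
proof (rule loc_integrable_bound[OF assms])
  have [measurable]: "f \<in> borel_measurable borel"
    using assms by (rule loc_integrable_measurable)
  show "demodulate f \<alpha> \<in> borel_measurable borel"
    unfolding demodulate_def by measurable
qed simp

text \<open>The set \<open>K\<close> only has to contain the frequencies with nonzero coefficient.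
  Fixing it in advance makes the class stable under sums, multiples and limits in mean, where
  \<open>cycle_freqs\<close> itself would change.\<close>

definition has_sine_coeffs :: "real set \<Rightarrow> (real \<Rightarrow> complex) \<Rightarrow> bool" where
  "has_sine_coeffs K g \<longleftrightarrow> loc_integrable g \<and>
     (\<forall>\<alpha>. \<exists>c. (time_avg_upto (demodulate g \<alpha>) \<longlongrightarrow> c) at_top \<and> (\<alpha> \<notin> K \<longrightarrow> c = 0))"

lemma has_sine_coeffs_imp_extractable:
  assumes "has_sine_coeffs K g" "countable K"
  shows "sine_extractable g"
proof -
  have "cycle_freqs g \<subseteq> K"
    using assms(1) sine_coeffI unfolding has_sine_coeffs_def cycle_freqs_def by fastforce
  then show ?thesis
    using assms countable_subset
    unfolding has_sine_coeffs_def sine_extractable_def loc_integrable_def by blast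
qed

lemma sine_extractable_imp_has_sine_coeffs:
  assumes "sine_extractable g" "g \<in> borel_measurable borel" "cycle_freqs g \<subseteq> K"
  shows "has_sine_coeffs K g"
  using assms sine_coeffI
  unfolding has_sine_coeffs_def sine_extractable_def loc_integrable_def cycle_freqs_def by blast

lemma has_sine_coeffs_add:
  assumes g: "has_sine_coeffs K g" and h: "has_sine_coeffs K h"
  shows "has_sine_coeffs K (\<lambda>u. g u + h u)"
  unfolding has_sine_coeffs_def
proof (intro conjI allI)
  have loc: "loc_integrable g" "loc_integrable h"
    using g h by (auto simp: has_sine_coeffs_def)
  then show "loc_integrable (\<lambda>u. g u + h u)"
    by (rule loc_integrable_add)
  fix \<alpha>
  obtain c d where c: "(time_avg_upto (demodulate g \<alpha>) \<longlongrightarrow> c) at_top" "\<alpha> \<notin> K \<longrightarrow> c = 0"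
    and d: "(time_avg_upto (demodulate h \<alpha>) \<longlongrightarrow> d) at_top" "\<alpha> \<notin> K \<longrightarrow> d = 0"
    using g h unfolding has_sine_coeffs_def by meson
  have "demodulate (\<lambda>u. g u + h u) \<alpha> = (\<lambda>u. demodulate g \<alpha> u + demodulate h \<alpha> u)"
    by (simp add: demodulate_def fun_eq_iff algebra_simps)
  moreover have "((\<lambda>T. time_avg_upto (\<lambda>u. demodulate g \<alpha> u + demodulate h \<alpha> u) T) \<longlongrightarrow> c + d) at_top"
    using c d loc
    by (subst time_avg_upto_add) (auto intro!: tendsto_intros loc_integrable_demodulate)
  ultimately show "\<exists>c. (time_avg_upto (demodulate (\<lambda>u. g u + h u) \<alpha>) \<longlongrightarrow> c) at_top \<and> (\<alpha> \<notin> K \<longrightarrow> c = 0)"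
    using c d by (intro exI[of _ "c + d"]) auto
qed

lemma has_sine_coeffs_cmult:
  assumes g: "has_sine_coeffs K g"
  shows "has_sine_coeffs K (\<lambda>u. a * g u)"
  unfolding has_sine_coeffs_def
proof (intro conjI allI)
  show "loc_integrable (\<lambda>u. a * g u)"
    using g by (intro loc_integrable_cmult) (auto simp: has_sine_coeffs_def)
  fix \<alpha>
  obtain c where c: "(time_avg_upto (demodulate g \<alpha>) \<longlongrightarrow> c) at_top" "\<alpha> \<notin> K \<longrightarrow> c = 0"
    using g unfolding has_sine_coeffs_def by meson
  have "demodulate (\<lambda>u. a * g u) \<alpha> = (\<lambda>u. a * demodulate g \<alpha> u)"
    by (simp add: demodulate_def fun_eq_iff algebra_simps)
  moreover have "((\<lambda>T. time_avg_upto (\<lambda>u. a * demodulate g \<alpha> u) T) \<longlongrightarrow> a * c) at_top"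
    using c by (subst time_avg_upto_cmult) (auto intro!: tendsto_intros)
  ultimately show "\<exists>c. (time_avg_upto (demodulate (\<lambda>u. a * g u) \<alpha>) \<longlongrightarrow> c) at_top \<and> (\<alpha> \<notin> K \<longrightarrow> c = 0)"
    using c by (intro exI[of _ "a * c"]) auto
qed

text \<open>Demodulating at \<alpha> after modulating by \<beta> is demodulating \<open>g\<close> at
  \<open>\<alpha> - \<beta>\<close>. Closure of \<open>K\<close> under adding \<beta> says
  contrapositively that \<open>\<alpha> \<notin> K\<close> gives
  \<open>\<alpha> - \<beta> \<notin> K\<close>.\<close>

lemma has_sine_coeffs_modulate:
  assumes g: "has_sine_coeffs K g" and K: "\<And>\<alpha>. \<alpha> \<in> K \<Longrightarrow> \<alpha> + \<beta> \<in> K"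
  shows "has_sine_coeffs K (\<lambda>u. cis (2 * pi * \<beta> * u) * g u)"
  unfolding has_sine_coeffs_def
proof (intro conjI allI)
  show "loc_integrable (\<lambda>u. cis (2 * pi * \<beta> * u) * g u)"
    using g by (intro loc_integrable_bounded_mult[where B = 1]) (auto simp: has_sine_coeffs_def)
  fix \<alpha>
  have "demodulate (\<lambda>u. cis (2 * pi * \<beta> * u) * g u) \<alpha> u = demodulate g (\<alpha> - \<beta>) u" for u
  proof -
    have "cis (2 * pi * \<beta> * u) * cis (- 2 * pi * \<alpha> * u) = cis (- 2 * pi * (\<alpha> - \<beta>) * u)"
      by (simp add: cis_mult algebra_simps)
    then show ?thesis
      unfolding demodulate_def by (metis mult.assoc mult.commute)
  qed
  then have "demodulate (\<lambda>u. cis (2 * pi * \<beta> * u) * g u) \<alpha> = demodulate g (\<alpha> - \<beta>)" ..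
  moreover have "\<alpha> - \<beta> \<notin> K" if "\<alpha> \<notin> K"
    using K[of "\<alpha> - \<beta>"] that by auto
  ultimately show "\<exists>c. (time_avg_upto (demodulate (\<lambda>u. cis (2 * pi * \<beta> * u) * g u) \<alpha>) \<longlongrightarrow> c) at_top \<and>
      (\<alpha> \<notin> K \<longrightarrow> c = 0)"
    using g unfolding has_sine_coeffs_def by metis
qed

lemma has_sine_coeffs_cos_mult:
  assumes g: "has_sine_coeffs K g" and K: "\<And>\<alpha>. \<alpha> \<in> K \<Longrightarrow> \<alpha> + \<beta> \<in> K \<and> \<alpha> - \<beta> \<in> K"
  shows "has_sine_coeffs K (\<lambda>u. complex_of_real (cos (2 * pi * \<beta> * u)) * g u)"
proof -
  have "complex_of_real (cos (2 * pi * \<beta> * u)) * g u =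
      1 / 2 * (cis (2 * pi * \<beta> * u) * g u + cis (2 * pi * (- \<beta>) * u) * g u)" for u
  proof -
    have "cis (2 * pi * \<beta> * u) + cis (2 * pi * (- \<beta>) * u) = 2 * complex_of_real (cos (2 * pi * \<beta> * u))"
      by (simp add: complex_eq_iff)
    then show ?thesis
      by (simp flip: distrib_right)
  qed
  moreover have "has_sine_coeffs K
      (\<lambda>u. 1 / 2 * (cis (2 * pi * \<beta> * u) * g u + cis (2 * pi * (- \<beta>) * u) * g u))"
    using K by (intro has_sine_coeffs_cmult has_sine_coeffs_add has_sine_coeffs_modulate g) auto
  ultimately show ?thesis by presburger
qed

text \<open>Induction over the polynomial with \<open>g\<close> left arbitrary: for a product, the
  hypothesis for \<open>p\<close> is applied to the function already multiplied by
  \<open>q\<close>.\<close>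

lemma has_sine_coeffs_poly_cos_mult:
  fixes p :: "real \<Rightarrow> real"
  assumes "real_polynomial_function p"
    and g: "has_sine_coeffs K g" and K: "\<And>\<alpha>. \<alpha> \<in> K \<Longrightarrow> \<alpha> + \<beta> \<in> K \<and> \<alpha> - \<beta> \<in> K"
  shows "has_sine_coeffs K (\<lambda>u. complex_of_real (p (cos (2 * pi * \<beta> * u))) * g u)"
  using assms(1) g
proof (induction arbitrary: g)
  case (linear p)
  \<comment> \<open>A linear map on the reals is multiplication by its value at 1.\<close>
  have "p y = p 1 * y" for y
    using linear_cmul[OF bounded_linear.linear[OF linear(1)], of y 1] by (simp add: mult.commute)
  then have "complex_of_real (p (cos (2 * pi * \<beta> * u))) * g u =
      complex_of_real (p 1) * (complex_of_real (cos (2 * pi * \<beta> * u)) * g u)" for u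
    by (metis mult.assoc of_real_mult)
  then show ?case
    using has_sine_coeffs_cmult[OF has_sine_coeffs_cos_mult[OF linear(2) K]] by presburger
next
  case (const c)
  then show ?case by (rule has_sine_coeffs_cmult)
next
  case (add p q)
  then show ?case
    using has_sine_coeffs_add[OF add.IH(1)[OF add.prems] add.IH(2)[OF add.prems]]
    by (simp add: algebra_simps)
next
  case (mult p q)
  then show ?case
    using mult.IH(1)[OF mult.IH(2)[OF mult.prems]] by (simp add: algebra_simps)
qed

text \<open>The limits of the approximants form a Cauchy sequence, because any two approximants stay
  close to the same \<open>F\<close>. Completeness gives a limit, the closed set \<open>C\<close>
  retains it, and a three-term estimate transfers the convergence to \<open>F\<close>.\<close>

lemma tendsto_of_approximable:
  fixes F :: "'b \<Rightarrow> 'a :: banach"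
  assumes ne: "X \<noteq> bot" and "closed C"
    and approx: "\<And>e. 0 < e \<Longrightarrow>
      \<exists>G c. (G \<longlongrightarrow> c) X \<and> c \<in> C \<and> (\<forall>\<^sub>F T in X. norm (F T - G T) \<le> e)"
  shows "\<exists>c\<in>C. (F \<longlongrightarrow> c) X"
proof -
  have "\<exists>G c. (G \<longlongrightarrow> c) X \<and> c \<in> C \<and> (\<forall>\<^sub>F T in X. norm (F T - G T) \<le> 1 / real (Suc n))" for n
    by (rule approx) simp
  then obtain G c where G: "\<And>n. (G n \<longlongrightarrow> c n) X" and C: "\<And>n. c n \<in> C"
    and le: "\<And>n. \<forall>\<^sub>F T in X. norm (F T - G n T) \<le> 1 / real (Suc n)"
    by metis
  have dist_c: "norm (c n - c m) \<le> 1 / real (Suc n) + 1 / real (Suc m)" for n m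
  proof (rule tendsto_upperbound[OF tendsto_norm[OF tendsto_diff[OF G G]] _ ne])
    show "\<forall>\<^sub>F T in X. norm (G n T - G m T) \<le> 1 / real (Suc n) + 1 / real (Suc m)"
      using le[of n] le[of m]
    proof eventually_elim
      case (elim T)
      have "norm (G n T - G m T) = norm ((F T - G m T) - (F T - G n T))"
        by simp
      also have "\<dots> \<le> norm (F T - G m T) + norm (F T - G n T)"
        by (rule norm_triangle_ineq4)
      finally show ?case
        using elim by simp
    qed
  qed
  have "Cauchy c"
  proof (rule CauchyI)
    fix e :: real assume "0 < e"
    then obtain N where N: "1 / real (Suc N) < e / 2"
      using reals_Archimedean[of "e / 2"] by (auto simp: inverse_eq_divide)
    have "norm (c m - c n) < e" if "m \<ge> N" "n \<ge> N" for m n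
    proof -
      have "1 / real (Suc m) \<le> 1 / real (Suc N)" "1 / real (Suc n) \<le> 1 / real (Suc N)"
        using that by (auto intro!: divide_left_mono)
      then show ?thesis
        using dist_c[of m n] N by linarith
    qed
    then show "\<exists>M. \<forall>m\<ge>M. \<forall>n\<ge>M. norm (c m - c n) < e"
      by blast
  qed
  then obtain l where l: "c \<longlonglongrightarrow> l"
    using Cauchy_convergent_iff convergent_def by blast
  have "l \<in> C"
    using C l \<open>closed C\<close> closed_sequentially by blast
  moreover have "(F \<longlongrightarrow> l) X"
  proof (rule tendstoI)
    fix e :: real assume "0 < e"
    have "\<forall>\<^sub>F n in sequentially. norm (c n - l) < e / 3"
      using tendstoD[OF l, of "e / 3"] \<open>0 < e\<close> by (simp add: dist_norm)
    moreover have "\<forall>\<^sub>F n in sequentially. 1 / real (Suc n) < e / 3"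
      using tendstoD[OF LIMSEQ_inverse_real_of_nat, of "e / 3"] \<open>0 < e\<close>
      by (simp add: inverse_eq_divide)
    ultimately have "\<forall>\<^sub>F n in sequentially. norm (c n - l) < e / 3 \<and> 1 / real (Suc n) < e / 3"
      by (rule eventually_conj)
    then obtain n where n: "norm (c n - l) < e / 3" "1 / real (Suc n) < e / 3"
      using eventually_happens'[OF sequentially_bot] by blast
    have "\<forall>\<^sub>F T in X. dist (G n T) (c n) < e / 3"
      using tendstoD[OF G[of n], of "e / 3"] \<open>0 < e\<close> by simp
    then show "\<forall>\<^sub>F T in X. dist (F T) l < e"
      using le[of n]
    proof eventually_elim
      case (elim T)
      have "dist (F T) l \<le> dist (F T) (G n T) + dist (G n T) (c n) + dist (c n) l"
        using dist_triangle[of "F T" l "G n T"] dist_triangle[of "G n T" l "c n"] by linarith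
      then show ?case
        using elim n by (simp add: dist_norm)
    qed
  qed
  ultimately show ?thesis ..
qed

text \<open>The demodulated averages of \<open>g\<close> and \<open>h\<close> differ by at most the
  mean of \<open>norm (g u - h u)\<close>, so existence of the limit and its vanishing both pass
  from the approximants to \<open>g\<close>.\<close>

lemma has_sine_coeffs_limit:
  assumes g: "loc_integrable g"
    and approx: "\<And>e. 0 < e \<Longrightarrow>
      \<exists>h. has_sine_coeffs K h \<and> (\<forall>\<^sub>F T in at_top. mean_upto (\<lambda>u. norm (g u - h u)) T \<le> e)"
  shows "has_sine_coeffs K g"
  unfolding has_sine_coeffs_def
proof (intro conjI allI g)
  fix \<alpha>
  \<comment> \<open>Membership in this closed set expresses that the coefficient vanishes when
    \<alpha> lies outside \<open>K\<close>.\<close>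
  define C :: "complex set" where "C = (if \<alpha> \<in> K then UNIV else {0})"
  have "\<exists>c\<in>C. (time_avg_upto (demodulate g \<alpha>) \<longlongrightarrow> c) at_top"
  proof (rule tendsto_of_approximable)
    show "closed C"
      by (simp add: C_def)
    fix e :: real assume "0 < e"
    then obtain h where h: "has_sine_coeffs K h"
      and le: "\<forall>\<^sub>F T in at_top. mean_upto (\<lambda>u. norm (g u - h u)) T \<le> e"
      using approx by blast
    have loc: "loc_integrable h"
      using h by (simp add: has_sine_coeffs_def)
    obtain c where "(time_avg_upto (demodulate h \<alpha>) \<longlongrightarrow> c) at_top" "c \<in> C"
      using h unfolding has_sine_coeffs_def C_def by (metis UNIV_I singletonI)
    moreover have "\<forall>\<^sub>F T in at_top.
        norm (time_avg_upto (demodulate g \<alpha>) T - time_avg_upto (demodulate h \<alpha>) T) \<le> e"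
      using le eventually_gt_at_top[of 0]
    proof eventually_elim
      case (elim T)
      have "time_avg_upto (demodulate g \<alpha>) T - time_avg_upto (demodulate h \<alpha>) T =
          time_avg_upto (demodulate (\<lambda>u. g u - h u) \<alpha>) T"
        by (simp add: time_avg_upto_diff[symmetric] loc_integrable_demodulate g loc)
          (simp add: demodulate_def[abs_def] algebra_simps)
      also have "norm \<dots> \<le> mean_upto (\<lambda>u. norm (g u - h u)) T"
        using norm_time_avg_upto_le[of "demodulate (\<lambda>u. g u - h u) \<alpha>" T] elim(2)
        by (simp add: loc_integrable_demodulate loc_integrable_diff g loc)
      finally show ?case
        using elim by simp
    qed
    ultimately show "\<exists>G c. (G \<longlongrightarrow> c) at_top \<and> c \<in> C \<and>
        (\<forall>\<^sub>F T in at_top. norm (time_avg_upto (demodulate g \<alpha>) T - G T) \<le> e)"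
      by blast
  qed simp
  then show "\<exists>c. (time_avg_upto (demodulate g \<alpha>) \<longlongrightarrow> c) at_top \<and> (\<alpha> \<notin> K \<longrightarrow> c = 0)"
    by (auto simp: C_def split: if_splits)
qed

section \<open>Pulse trains\<close>

text \<open>For positive \<open>Ts\<close>, the translates of this half-open block by multiples of
  \<open>Ts\<close> are centred at the pulses and tile the line; \<open>window Ts N\<close> is the
  union of those with indices from \<open>- N\<close> to \<open>N\<close>.\<close>

abbreviation block :: "real \<Rightarrow> real set" where
  "block Ts \<equiv> {- Ts / 2..<Ts / 2}"

abbreviation window :: "real \<Rightarrow> nat \<Rightarrow> real set" where
  "window Ts N \<equiv> {- ((real N + 1 / 2) * Ts)..<(real N + 1 / 2) * Ts}"

lemma mem_block_shift_iff:
  assumes "0 < Ts"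
  shows "u - of_int m * Ts \<in> block Ts \<longleftrightarrow> m = \<lfloor>u / Ts + 1 / 2\<rfloor>"
proof -
  have "u - of_int m * Ts \<in> block Ts \<longleftrightarrow> of_int m \<le> u / Ts + 1 / 2 \<and> u / Ts + 1 / 2 < of_int m + 1"
    using assms by (auto simp: field_simps)
  also have "\<dots> \<longleftrightarrow> m = \<lfloor>u / Ts + 1 / 2\<rfloor>"
    using floor_correct[of "u / Ts + 1 / 2"] floor_unique[of m "u / Ts + 1 / 2"] by auto
  finally show ?thesis .
qed

lemma indicator_window:
  fixes u :: real
  assumes "0 < Ts"
  shows "indicator (window Ts N) u =
    (\<Sum>m\<in>{- int N..int N}. indicator (block Ts) (u - of_int m * Ts) :: 'a :: semiring_1)"
proof -
  have "u \<in> window Ts N \<longleftrightarrow> of_int (- int N) \<le> u / Ts + 1 / 2 \<and> u / Ts + 1 / 2 < of_int (int N + 1)"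
    using assms by (auto simp: field_simps)
  also have "\<dots> \<longleftrightarrow> \<lfloor>u / Ts + 1 / 2\<rfloor> \<in> {- int N..int N}"
    unfolding le_floor_iff[symmetric] floor_less_iff[symmetric] by auto
  finally show ?thesis
    unfolding indicator_def mem_block_shift_iff[OF assms] of_bool_def
    by (simp only: sum.delta finite_atLeastAtMost_int)
qed

text \<open>Translating each block to the origin turns the integral over a long window into sums of
  samples with a common phase \<open>s\<close>, a form in which the weights of a pulse train enter
  one per sample.\<close>

lemma set_integral_window:
  fixes g :: "real \<Rightarrow> 'a :: {banach, second_countable_topology}"
  assumes "0 < Ts" and g: "loc_integrable g"
  shows "(LBINT u:window Ts N. g u) =
    (\<Sum>m\<in>{- int N..int N}. LBINT s:block Ts. g (s + of_int m * Ts))"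
proof -
  have int: "integrable lborel (\<lambda>u. indicator (block Ts) (u - of_int m * Ts) *\<^sub>R g u)" for m
  proof -
    have "indicator (block Ts) (u - of_int m * Ts) =
        (indicator {- Ts / 2 + of_int m * Ts..<Ts / 2 + of_int m * Ts} u :: real)" for u
      by (auto simp: indicator_def)
    then show ?thesis
      using loc_integrableD(2)[OF g] by (simp add: set_integrable_def)
  qed
  have "(LBINT u:window Ts N. g u) =
      (\<integral>u. (\<Sum>m\<in>{- int N..int N}. indicator (block Ts) (u - of_int m * Ts) *\<^sub>R g u) \<partial>lborel)"
    unfolding set_lebesgue_integral_def indicator_window[OF assms(1)] by (simp add: scaleR_sum_left)
  also have "\<dots> = (\<Sum>m\<in>{- int N..int N}. \<integral>u. indicator (block Ts) (u - of_int m * Ts) *\<^sub>R g u \<partial>lborel)"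
    by (intro Bochner_Integration.integral_sum int)
  also have "\<dots> = (\<Sum>m\<in>{- int N..int N}. LBINT s:block Ts. g (s + of_int m * Ts))"
  proof (intro sum.cong refl)
    fix m :: int
    show "(\<integral>u. indicator (block Ts) (u - of_int m * Ts) *\<^sub>R g u \<partial>lborel) =
        (LBINT s:block Ts. g (s + of_int m * Ts))"
      unfolding set_lebesgue_integral_def
      by (subst lborel_integral_real_affine[where c = 1 and t = "of_int m * Ts"])
        (simp_all add: add.commute)
  qed
  finally show ?thesis .
qed

lemma set_integral_window_mono:
  fixes h :: "real \<Rightarrow> real"
  assumes h: "loc_integrable h" "\<And>u. 0 \<le> h u" and "T / 2 < (real N + 1 / 2) * Ts"
  shows "(LBINT u:{- T / 2..T / 2}. h u) \<le> (LBINT u:window Ts N. h u)"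
  unfolding set_lebesgue_integral_def
  using loc_integrableD(1)[OF h(1), of "- T / 2" "T / 2"] loc_integrableD(2)[OF h(1)] assms(2,3)
  unfolding set_integrable_def by (intro integral_mono) (auto simp: indicator_def)

text \<open>The window is covered by \<open>2 * N + 1\<close> whole blocks with equal integrals. The
  constant 4 absorbs the rounding: \<open>2 * N + 1 < T / Ts + 3\<close>, which is at most
  \<open>4 * (T / Ts)\<close> because \<open>Ts \<le> T\<close>.\<close>

lemma mean_upto_periodic:
  fixes h :: "real \<Rightarrow> real"
  assumes Ts: "0 < Ts" and h: "loc_integrable h" "\<And>u. 0 \<le> h u"
    and periodic: "\<And>s m. h (s + of_int m * Ts) = h s" and T: "Ts \<le> T"
  shows "mean_upto h T \<le> 4 / Ts * (LBINT s:block Ts. h s)"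
proof -
  define N where "N = nat \<lceil>T / (2 * Ts)\<rceil>"
  define I where "I = (LBINT s:block Ts. h s)"
  have "0 \<le> I"
    unfolding I_def set_lebesgue_integral_def using h(2) by (intro Bochner_Integration.integral_nonneg) auto
  have pos: "0 < T / (2 * Ts)"
    using Ts T by simp
  have N: "T / (2 * Ts) \<le> real N" "real N < T / (2 * Ts) + 1"
    using pos unfolding N_def by linarith+
  have le: "2 * real N + 1 \<le> 4 * (T / Ts)"
  proof -
    have "1 \<le> T / Ts" "T / (2 * Ts) = T / Ts / 2"
      using Ts T by simp_all
    then show ?thesis
      using N(2) by simp
  qed
  have "T / 2 < (real N + 1 / 2) * Ts"
    using N(1) Ts by (simp add: field_simps)
  then have "(LBINT u:{- T / 2..T / 2}. h u) \<le> (LBINT u:window Ts N. h u)"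
    by (intro set_integral_window_mono h)
  also have "\<dots> = (2 * real N + 1) * I"
    by (simp add: set_integral_window[OF Ts h(1)] periodic I_def)
  also have "\<dots> \<le> 4 * (T / Ts) * I"
    by (intro mult_right_mono le \<open>0 \<le> I\<close>)
  finally have "mean_upto h T \<le> 4 * (T / Ts) * I / T"
    unfolding mean_upto_def using T Ts by (intro divide_right_mono) auto
  then show ?thesis
    using T Ts by (simp add: I_def)
qed

section \<open>The pulse train as a function of a cosine\<close>

lemma sampler_const_periodic:
  "0 < Ts \<Longrightarrow> sampler (\<lambda>_. c) Ts \<upsilon> (s + of_int m * Ts) = sampler (\<lambda>_. c) Ts \<upsilon> s"
proof -
  assume "0 < Ts"
  then have "(s + of_int m * Ts) / Ts + 1 / 2 = s / Ts + 1 / 2 + of_int m"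
    by (simp add: field_simps)
  then have "\<lfloor>(s + of_int m * Ts) / Ts + 1 / 2\<rfloor> = \<lfloor>s / Ts + 1 / 2\<rfloor> + m"
    by (metis floor_add_int)
  then show ?thesis
    by (simp add: sampler_def algebra_simps)
qed

lemma sampler_block:
  assumes "0 < Ts" "s \<in> block Ts"
  shows "sampler b Ts \<upsilon> (s + of_int m * Ts) = b m * p_sh \<upsilon> s"
proof -
  have "m = \<lfloor>(s + of_int m * Ts) / Ts + 1 / 2\<rfloor>"
    using mem_block_shift_iff[OF assms(1), of "s + of_int m * Ts" m] assms(2) by simp
  then show ?thesis
    unfolding sampler_def by (metis add_diff_cancel_right')
qed

text \<open>The cosine decreases on \<open>{0..pi}\<close>, so
  \<open>\<bar>s\<bar> \<le> \<upsilon> / 2\<close> becomes a lower bound on the cosine. Polynomials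
  in the cosine can then approximate the pulse train.\<close>

lemma pulse_eq_cos_superlevel:
  assumes "0 < \<upsilon>" "\<upsilon> < Ts" "s \<in> block Ts"
  shows "p_sh \<upsilon> s = (if cos (pi * \<upsilon> / Ts) \<le> cos (2 * pi * s / Ts) then 1 else 0)"
proof -
  have "cos (2 * pi * s / Ts) = cos (2 * pi * \<bar>s\<bar> / Ts)"
    by (cases "0 \<le> s") auto
  moreover have "2 * pi * \<bar>s\<bar> / Ts \<le> pi"
    using assms by (auto simp: field_simps abs_if)
  moreover have "pi * \<upsilon> / Ts \<le> pi"
    using assms by (simp add: field_simps)
  ultimately have "cos (pi * \<upsilon> / Ts) \<le> cos (2 * pi * s / Ts) \<longleftrightarrow> 2 * pi * \<bar>s\<bar> / Ts \<le> pi * \<upsilon> / Ts"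
    using assms by (subst \<open>cos (2 * pi * s / Ts) = _\<close>, subst cos_mono_le_eq) auto
  also have "\<dots> \<longleftrightarrow> \<bar>s\<bar> \<le> \<upsilon> / 2"
    using assms by (simp add: field_simps)
  finally show ?thesis
    using assms by (simp add: p_sh_altdef)
qed

text \<open>Weierstrass approximation of ramps that steepen to the step. Convergence is only
  pointwise, but the uniform bound 2 (ramp values up to 1, error up to 1) makes dominated
  convergence available.\<close>

lemma step_approx_polynomials:
  fixes c :: real
  obtains p :: "nat \<Rightarrow> real \<Rightarrow> real" where
    "\<And>k. real_polynomial_function (p k)"
    "\<And>k y. \<bar>y\<bar> \<le> 1 \<Longrightarrow> \<bar>p k y\<bar> \<le> 2"
    "\<And>y. \<bar>y\<bar> \<le> 1 \<Longrightarrow> (\<lambda>k. p k y) \<longlonglongrightarrow> (if c \<le> y then 1 else 0)"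
proof -
  \<comment> \<open>The ramp rises to the left of \<open>c\<close> and equals 1 from
    \<open>c\<close> on, so the limit at the jump is 1, in accordance with the closed
    pulses.\<close>
  define ramp where "ramp k y = max 0 (min 1 (1 + real k * (y - c)))" for k y
  have "\<exists>p. real_polynomial_function p \<and> (\<forall>y\<in>{-1..1}. \<bar>ramp k y - p y\<bar> < 1 / real (Suc k))" for k
  proof -
    have "continuous_on {-1..1} (ramp k)"
      unfolding ramp_def by (intro continuous_intros)
    then obtain p where "real_polynomial_function p"
      "\<And>y. y \<in> {-1..1} \<Longrightarrow> \<bar>ramp k y - p y\<bar> < 1 / real (Suc k)"
      using Stone_Weierstrass_real_polynomial_function[of "{-1..1::real}" "ramp k" "1 / real (Suc k)"]
      by auto
    then show ?thesis by blast
  qed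
  then obtain p where poly: "\<And>k. real_polynomial_function (p k)"
    and close: "\<And>k y. y \<in> {-1..1} \<Longrightarrow> \<bar>ramp k y - p k y\<bar> < 1 / real (Suc k)"
    by metis
  show thesis
  proof
    show "real_polynomial_function (p k)" for k
      by (rule poly)
  next
    fix k and y :: real assume y: "\<bar>y\<bar> \<le> 1"
    have "1 / real (Suc k) \<le> 1" "0 \<le> ramp k y" "ramp k y \<le> 1"
      by (auto simp: ramp_def)
    then show "\<bar>p k y\<bar> \<le> 2"
      using close[of y k] y unfolding abs_le_iff abs_less_iff atLeastAtMost_iff by linarith
  next
    fix y :: real assume y: "\<bar>y\<bar> \<le> 1"
    have ramp: "(\<lambda>k. ramp k y) \<longlonglongrightarrow> (if c \<le> y then 1 else 0)"
    proof (cases "c \<le> y")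
      case True
      then have "ramp k y = 1" for k
        by (simp add: ramp_def)
      then show ?thesis
        using True by simp
    next
      case False
      then obtain K where K: "1 < real K * (c - y)"
        using reals_Archimedean3[of "c - y"] by auto
      have "ramp k y = 0" if "K \<le> k" for k
      proof -
        have "real K * (c - y) \<le> real k * (c - y)"
          using that False by (intro mult_right_mono) auto
        then show ?thesis
          using K by (simp add: ramp_def algebra_simps)
      qed
      then have "\<forall>\<^sub>F k in sequentially. ramp k y = 0"
        by (auto simp: eventually_sequentially)
      then show ?thesis
        using False by (simp add: tendsto_eventually)
    qed
    have "(\<lambda>k. ramp k y - p k y) \<longlonglongrightarrow> 0"
    proof (rule Lim_null_comparison)
      show "\<forall>\<^sub>F k in sequentially. norm (ramp k y - p k y) \<le> inverse (real (Suc k))"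
        using close[of y] y
        by (intro always_eventually allI) (simp add: abs_le_iff[of y] inverse_eq_divide less_imp_le)
    qed (rule LIMSEQ_inverse_real_of_nat)
    from tendsto_diff[OF ramp this] show "(\<lambda>k. p k y) \<longlonglongrightarrow> (if c \<le> y then 1 else 0)"
      by simp
  qed
qed

text \<open>Multiplying \<open>f\<close> by the polynomials \<open>P k\<close> keeps its frequencies
  within \<open>K\<close>. Their distance to the train is small only in mean square over a period,
  so it is balanced against the quadratic mean of \<open>f\<close>.\<close>

lemma has_sine_coeffs_pulse_train:
  assumes \<upsilon>: "0 < \<upsilon>" "\<upsilon> < Ts" and f: "has_sine_coeffs K f"
    and sq: "loc_integrable (\<lambda>u. (norm (f u))\<^sup>2)"
      "(mean_upto (\<lambda>u. (norm (f u))\<^sup>2) \<longlongrightarrow> A) at_top"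
    and K: "\<And>\<alpha>. \<alpha> \<in> K \<Longrightarrow> \<alpha> + 1 / Ts \<in> K \<and> \<alpha> - 1 / Ts \<in> K"
  shows "has_sine_coeffs K (\<lambda>u. f u * complex_of_real (sampler (\<lambda>_. 1) Ts \<upsilon> u))"
proof -
  have Ts: "0 < Ts"
    using \<upsilon> by simp
  define S where "S = sampler (\<lambda>_. 1) Ts \<upsilon>"
  define c where "c = cos (pi * \<upsilon> / Ts)"
  obtain p where poly: "\<And>k. real_polynomial_function (p k)"
    and p_le: "\<And>k y. \<bar>y\<bar> \<le> 1 \<Longrightarrow> \<bar>p k y\<bar> \<le> 2"
    and p_lim: "\<And>y. \<bar>y\<bar> \<le> 1 \<Longrightarrow> (\<lambda>k. p k y) \<longlonglongrightarrow> (if c \<le> y then 1 else 0)"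
    using step_approx_polynomials[of c] by metis
  define P where "P k u = p k (cos (2 * pi * (1 / Ts) * u))" for k u
  have [measurable]: "S \<in> borel_measurable borel"
    unfolding S_def by (rule sampler_measurable)
  have [measurable]: "P k \<in> borel_measurable borel" for k
  proof -
    have "continuous_on UNIV (p k)"
      using continuous_real_polymonial_function[OF poly]
      by (intro continuous_at_imp_continuous_on) auto
    then have [measurable]: "p k \<in> borel_measurable borel"
      by (rule borel_measurable_continuous_onI)
    show ?thesis
      unfolding P_def by measurable
  qed
  have P_le: "\<bar>P k u\<bar> \<le> 2" for k u
    unfolding P_def by (intro p_le) simp
  have S_le: "\<bar>S u\<bar> \<le> 1" for u
    unfolding S_def by (intro sampler_bound) simp
  define D where "D k u = (S u - P k u)\<^sup>2" for k u
  \<comment> \<open>The constant is the square of 1 + 2, the bounds on \<open>S\<close> and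
    \<open>P k\<close>.\<close>
  have D_le: "D k u \<le> 9" for k u
  proof -
    have "\<bar>S u - P k u\<bar> \<le> 3"
      using P_le[of k u] S_le[of u] by linarith
    then show ?thesis
      unfolding D_def using power_mono[of "\<bar>S u - P k u\<bar>" 3 2] by simp
  qed
  have D_loc: "loc_integrable (D k)" for k
    by (rule loc_integrable_bound[OF loc_integrable_const[of "9 :: real"]])
      (use D_le in \<open>auto simp: D_def[abs_def]\<close>)
  have D_lim: "(\<lambda>k. LBINT s:block Ts. D k s) \<longlonglongrightarrow> 0"
  proof -
    have "(\<lambda>k. LBINT s:block Ts. D k s) \<longlonglongrightarrow> (LBINT s:block Ts. 0)"
      unfolding set_lebesgue_integral_def
    proof (rule integral_dominated_convergence[where w = "\<lambda>s. indicator (block Ts) s *\<^sub>R 9"])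
      show "integrable lborel (\<lambda>s. indicator (block Ts) s *\<^sub>R (9 :: real))"
        using loc_integrableD(2)[OF loc_integrable_const] unfolding set_integrable_def .
      show "AE s in lborel. (\<lambda>k. indicator (block Ts) s *\<^sub>R D k s) \<longlonglongrightarrow> indicator (block Ts) s *\<^sub>R 0"
      proof (rule AE_I2)
        fix s :: real
        have "(\<lambda>k. D k s) \<longlonglongrightarrow> 0" if s: "s \<in> block Ts"
        proof -
          have "S s = (if c \<le> cos (2 * pi * (1 / Ts) * s) then 1 else 0)"
            using sampler_block[OF Ts s, of "\<lambda>_. 1" \<upsilon> 0] pulse_eq_cos_superlevel[OF \<upsilon> s]
            by (simp add: S_def c_def)
          then have "(\<lambda>k. P k s) \<longlonglongrightarrow> S s"
            unfolding P_def using p_lim[of "cos (2 * pi * (1 / Ts) * s)"] by simp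
          then have "(\<lambda>k. (S s - P k s)\<^sup>2) \<longlonglongrightarrow> (S s - S s)\<^sup>2"
            by (intro tendsto_intros)
          then show ?thesis
            by (simp add: D_def)
        qed
        then show "(\<lambda>k. indicator (block Ts) s *\<^sub>R D k s) \<longlonglongrightarrow> indicator (block Ts) s *\<^sub>R 0"
          by (cases "s \<in> block Ts") auto
      qed
      show "AE s in lborel. norm (indicator (block Ts) s *\<^sub>R D k s) \<le> indicator (block Ts) s *\<^sub>R 9" for k
        using D_le by (auto simp: indicator_def D_def)
    qed (auto simp: D_def)
    then show ?thesis by simp
  qed
  have loc_f: "loc_integrable f"
    using f by (simp add: has_sine_coeffs_def)
  have [measurable]: "f \<in> borel_measurable borel"
    using loc_f by (rule loc_integrable_measurable)
  have P_f: "has_sine_coeffs K (\<lambda>u. complex_of_real (P k u) * f u)" for k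
    unfolding P_def by (intro has_sine_coeffs_poly_cos_mult poly f K)
  have S_f: "loc_integrable (\<lambda>u. f u * complex_of_real (S u))"
    by (rule loc_integrable_bound[OF loc_f])
      (use S_le in \<open>auto simp: norm_mult mult_left_le\<close>)
  show ?thesis
  proof (rule has_sine_coeffs_limit)
    show "loc_integrable (\<lambda>u. f u * complex_of_real (sampler (\<lambda>_. 1) Ts \<upsilon> u))"
      using S_f by (simp add: S_def)
    fix e :: real assume e: "0 < e"
    \<comment> \<open>As \<open>A < B\<close>, the quadratic means are eventually below
      \<open>B\<close>, and \<open>\<delta> * B = e\<close>. The index \<open>k\<close> is then
      taken so late that the mean of \<open>D k\<close> is at most \<open>\<delta> * e\<close>; each
      of the two terms contributes \<open>e / 2\<close>.\<close>
    define B where "B = \<bar>A\<bar> + 1"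
    define \<delta> where "\<delta> = e / B"
    have B: "0 < B" "A < B" and \<delta>: "0 < \<delta>" "\<delta> * B = e"
      using e by (auto simp: B_def \<delta>_def)
    have "\<forall>\<^sub>F k in sequentially. 4 / Ts * (LBINT s:block Ts. D k s) < \<delta> * e"
      using D_lim \<delta> e Ts by (intro order_tendstoD(2)[of _ 0]) (auto intro!: tendsto_eq_intros)
    then obtain k where k: "4 / Ts * (LBINT s:block Ts. D k s) < \<delta> * e"
      using eventually_happens'[OF sequentially_bot] by blast
    let ?h = "\<lambda>u. complex_of_real (P k u) * f u"
    have "\<forall>\<^sub>F T in at_top. mean_upto (\<lambda>u. norm (f u * complex_of_real (S u) - ?h u)) T \<le> e"
      using order_tendstoD(2)[OF sq(2) B(2)] eventually_ge_at_top[of Ts]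
    proof eventually_elim
      case (elim T)
      have amgm: "norm (f u * complex_of_real (S u) - ?h u) \<le>
          \<delta> / 2 * (norm (f u))\<^sup>2 + 1 / (2 * \<delta>) * D k u" for u
      proof -
        have "norm (f u * complex_of_real (S u) - ?h u) = norm (f u) * \<bar>S u - P k u\<bar>"
        proof -
          have "f u * complex_of_real (S u) - ?h u = f u * complex_of_real (S u - P k u)"
            by (simp add: algebra_simps)
          then show ?thesis
            by (simp only: norm_mult norm_of_real)
        qed
        also have "\<dots> \<le> \<delta> / 2 * (norm (f u))\<^sup>2 + 1 / (2 * \<delta>) * \<bar>S u - P k u\<bar>\<^sup>2"
        proof -
          \<comment> \<open>Dividing the expanded square by \<open>2 * \<delta>\<close> gives the
            weighted arithmetic-geometric mean inequality.\<close>
          have "0 \<le> (\<delta> * norm (f u) - \<bar>S u - P k u\<bar>)\<^sup>2"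
            by simp
          then show ?thesis
            using \<delta>(1) by (simp add: field_simps power2_eq_square)
        qed
        finally show ?thesis
          by (simp add: D_def)
      qed
      have loc1: "loc_integrable (\<lambda>u. \<delta> / 2 * (norm (f u))\<^sup>2)"
        and loc2: "loc_integrable (\<lambda>u. 1 / (2 * \<delta>) * D k u)"
        by (intro loc_integrable_cmult sq(1) D_loc)+
      have periodic: "D k (s + of_int m * Ts) = D k s" for s m
      proof -
        have "2 * pi * (1 / Ts) * (s + of_int m * Ts) = 2 * pi * (1 / Ts) * s + 2 * pi * of_int m"
          using Ts by (simp add: field_simps)
        then have "cos (2 * pi * (1 / Ts) * (s + of_int m * Ts)) = cos (2 * pi * (1 / Ts) * s)"
          by (simp add: cos_add sin_int_2pin cos_int_2pin del: times_divide_eq_left times_divide_eq_right)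
        then show ?thesis
          by (simp add: D_def P_def S_def sampler_const_periodic[OF Ts])
      qed
      have "mean_upto (\<lambda>u. norm (f u * complex_of_real (S u) - ?h u)) T \<le>
          mean_upto (\<lambda>u. \<delta> / 2 * (norm (f u))\<^sup>2 + 1 / (2 * \<delta>) * D k u) T"
        using elim Ts P_f[of k] amgm
        by (intro mean_upto_mono loc_integrable_norm loc_integrable_diff S_f loc_integrable_add loc1 loc2)
          (auto simp: has_sine_coeffs_def)
      also have "\<dots> = \<delta> / 2 * mean_upto (\<lambda>u. (norm (f u))\<^sup>2) T + 1 / (2 * \<delta>) * mean_upto (D k) T"
        by (simp only: mean_upto_add[OF loc1 loc2] mean_upto_cmult)
      also have "\<dots> \<le> \<delta> / 2 * B + 1 / (2 * \<delta>) * (\<delta> * e)"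
      proof -
        have "0 \<le> D k u" for u
          by (simp add: D_def)
        then have "mean_upto (D k) T \<le> \<delta> * e"
          using mean_upto_periodic[OF Ts D_loc _ periodic elim(2)] k by fastforce
        then show ?thesis
          using elim(1) \<delta>(1) by (intro add_mono mult_left_mono) auto
      qed
      also have "\<dots> = e"
        using \<delta> by (simp add: field_simps)
      finally show ?case .
    qed
    then show "\<exists>h. has_sine_coeffs K h \<and> (\<forall>\<^sub>F T in at_top. mean_upto
        (\<lambda>u. norm (f u * complex_of_real (sampler (\<lambda>_. 1) Ts \<upsilon> u) - h u)) T \<le> e)"
      using P_f[of k] unfolding S_def by blast
  qed
qed

section \<open>Correlations of modulated random sums\<close>

text \<open>The inner sums are the aperiodic correlations of \<open>d\<close>; the range of
  \<open>h\<close> contains all differences of indices in \<open>{- N..N}\<close>. The definition is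
  applied to sequences that vanish outside this range.\<close>

definition corr_energy :: "nat \<Rightarrow> (int \<Rightarrow> complex) \<Rightarrow> real" where
  "corr_energy N d = (\<Sum>h\<in>{- 2 * int N..2 * int N}.
     (norm (\<Sum>l\<in>{- int N..int N}. d (l + h) * cnj (d l)))\<^sup>2)"

text \<open>
  Expanding the square and grouping the products by the difference \<open>h\<close> of the indices isolates the
  frequency in a unimodular factor, so that the bound is uniform in \<open>\<theta>\<close>.
\<close>

lemma exp_sum_le_corr_energy:
  fixes d :: "int \<Rightarrow> complex"
  assumes d: "\<And>m. m \<notin> {- int N..int N} \<Longrightarrow> d m = 0"
  shows "(norm (\<Sum>m\<in>{- int N..int N}. d m * cis (\<theta> * of_int m))) ^ 4 \<le>
    (4 * real N + 1) * corr_energy N d"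
proof -
  define V where "V = {- int N..int N}"
  define H where "H = {- 2 * int N..2 * int N}"
  define C where "C h = (\<Sum>l\<in>V. d (l + h) * cnj (d l))" for h
  define e where "e m = d m * cis (\<theta> * of_int m)" for m
  \<comment> \<open>Shifting \<open>H\<close> by any \<open>l \<in> V\<close> covers
    \<open>V\<close>, and the surplus terms vanish with \<open>d\<close>. The range of
    \<open>h\<close> is thus independent of \<open>l\<close>, which allows the sums to be
    exchanged.\<close>
  have shift: "(\<Sum>j\<in>V. e j) = (\<Sum>h\<in>H. e (l + h))" if "l \<in> V" for l
  proof -
    have "V \<subseteq> (+) l ` H"
    proof
      fix j assume "j \<in> V"
      then have "j - l \<in> H"
        using that by (auto simp: V_def H_def)
      then show "j \<in> (+) l ` H"
        by (intro image_eqI[of _ _ "j - l"]) auto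
    qed
    then have "(\<Sum>j\<in>V. e j) = (\<Sum>j\<in>(+) l ` H. e j)"
      using d by (intro sum.mono_neutral_left) (auto simp: H_def V_def e_def)
    also have "\<dots> = (\<Sum>h\<in>H. e (l + h))"
      by (subst sum.reindex) auto
    finally show ?thesis .
  qed
  have "complex_of_real ((norm (\<Sum>j\<in>V. e j))\<^sup>2) = (\<Sum>j\<in>V. e j) * cnj (\<Sum>l\<in>V. e l)"
    by (rule complex_norm_square)
  also have "\<dots> = (\<Sum>l\<in>V. (\<Sum>j\<in>V. e j) * cnj (e l))"
    by (simp add: sum_distrib_left)
  also have "\<dots> = (\<Sum>l\<in>V. \<Sum>h\<in>H. e (l + h) * cnj (e l))"
    by (intro sum.cong refl) (simp add: shift sum_distrib_right)
  also have "\<dots> = (\<Sum>h\<in>H. \<Sum>l\<in>V. e (l + h) * cnj (e l))"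
    by (rule sum.swap)
  also have "\<dots> = (\<Sum>h\<in>H. cis (\<theta> * of_int h) * C h)"
  proof (intro sum.cong refl)
    fix h
    have "e (l + h) * cnj (e l) = cis (\<theta> * of_int h) * (d (l + h) * cnj (d l))" for l
    proof -
      have "cis (\<theta> * of_int (l + h)) * cis (- (\<theta> * of_int l)) = cis (\<theta> * of_int h)"
        by (simp add: cis_mult algebra_simps)
      then show ?thesis
        unfolding e_def by (simp add: cis_cnj mult_ac)
    qed
    then show "(\<Sum>l\<in>V. e (l + h) * cnj (e l)) = cis (\<theta> * of_int h) * C h"
      by (simp add: C_def sum_distrib_left)
  qed
  finally have eq: "complex_of_real ((norm (\<Sum>j\<in>V. e j))\<^sup>2) = (\<Sum>h\<in>H. cis (\<theta> * of_int h) * C h)" .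
  have "(norm (\<Sum>j\<in>V. e j))\<^sup>2 = norm (complex_of_real ((norm (\<Sum>j\<in>V. e j))\<^sup>2))"
    by (simp only: norm_of_real abs_power2)
  also have "\<dots> \<le> (\<Sum>h\<in>H. norm (C h))"
    unfolding eq by (rule order_trans[OF norm_sum]) (simp add: norm_mult)
  finally have "((norm (\<Sum>j\<in>V. e j))\<^sup>2)\<^sup>2 \<le> (\<Sum>h\<in>H. norm (C h))\<^sup>2"
    by (intro power_mono) auto
  \<comment> \<open>Cauchy-Schwarz over the \<open>4 * N + 1\<close> lags passes from moduli to
    squares, whose expectations can be computed.\<close>
  also have "\<dots> \<le> (\<Sum>h\<in>H. (norm (C h))\<^sup>2) * real (card H)"
    using Cauchy_Schwarz_ineq_sum[of "\<lambda>h. norm (C h)" "\<lambda>_. 1" H] by simp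
  also have "real (card H) = 4 * real N + 1"
    by (simp add: H_def)
  finally show ?thesis
    by (simp add: corr_energy_def C_def e_def V_def H_def mult.commute flip: power_mult)
qed

section \<open>Moments of independent centred weights\<close>

context prob_space
begin

text \<open>Expanding the square leaves only the diagonal by orthogonality, and there the second
  moments are at most 1.\<close>

lemma expectation_norm_square_orthogonal:
  fixes Y :: "'i \<Rightarrow> 'a \<Rightarrow> real" and b :: "'i \<Rightarrow> complex"
  assumes int: "\<And>l k. l \<in> V \<Longrightarrow> k \<in> V \<Longrightarrow> integrable M (\<lambda>\<omega>. Y l \<omega> * Y k \<omega>)"
    and ortho: "\<And>l k. l \<in> V \<Longrightarrow> k \<in> V \<Longrightarrow> l \<noteq> k \<Longrightarrow> expectation (\<lambda>\<omega>. Y l \<omega> * Y k \<omega>) = 0"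
    and le: "\<And>l. l \<in> V \<Longrightarrow> expectation (\<lambda>\<omega>. Y l \<omega> * Y l \<omega>) \<le> 1"
    and V: "finite V"
  shows "integrable M (\<lambda>\<omega>. (norm (\<Sum>l\<in>V. of_real (Y l \<omega>) * b l))\<^sup>2)"
    and "expectation (\<lambda>\<omega>. (norm (\<Sum>l\<in>V. of_real (Y l \<omega>) * b l))\<^sup>2) \<le> (\<Sum>l\<in>V. (norm (b l))\<^sup>2)"
proof -
  have expand: "(norm (\<Sum>l\<in>V. of_real (Y l \<omega>) * b l))\<^sup>2 =
      (\<Sum>l\<in>V. \<Sum>k\<in>V. Re (b l * cnj (b k)) * (Y l \<omega> * Y k \<omega>))" for \<omega>
  proof -
    have "(norm (\<Sum>l\<in>V. of_real (Y l \<omega>) * b l))\<^sup>2 =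
        Re ((\<Sum>l\<in>V. of_real (Y l \<omega>) * b l) * cnj (\<Sum>k\<in>V. of_real (Y k \<omega>) * b k))"
      by (metis Re_complex_of_real complex_norm_square)
    also have "\<dots> = (\<Sum>l\<in>V. \<Sum>k\<in>V. Re ((of_real (Y l \<omega>) * b l) * cnj (of_real (Y k \<omega>) * b k)))"
      by (simp only: cnj_sum sum_product Re_sum)
    also have "\<dots> = (\<Sum>l\<in>V. \<Sum>k\<in>V. Re (b l * cnj (b k)) * (Y l \<omega> * Y k \<omega>))"
      by (intro sum.cong refl) (simp add: algebra_simps)
    finally show ?thesis .
  qed
  show "integrable M (\<lambda>\<omega>. (norm (\<Sum>l\<in>V. of_real (Y l \<omega>) * b l))\<^sup>2)"
    unfolding expand by (intro Bochner_Integration.integrable_sum integrable_mult_right int)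
  have "expectation (\<lambda>\<omega>. (norm (\<Sum>l\<in>V. of_real (Y l \<omega>) * b l))\<^sup>2) =
      (\<Sum>l\<in>V. \<Sum>k\<in>V. Re (b l * cnj (b k)) * expectation (\<lambda>\<omega>. Y l \<omega> * Y k \<omega>))"
    unfolding expand
    by (simp add: Bochner_Integration.integral_sum int)
  also have "\<dots> = (\<Sum>l\<in>V. \<Sum>k\<in>V. if k = l then (norm (b l))\<^sup>2 * expectation (\<lambda>\<omega>. Y l \<omega> * Y l \<omega>) else 0)"
  proof (intro sum.cong refl)
    fix l k assume "l \<in> V" "k \<in> V"
    moreover have "Re (b l * cnj (b l)) = (norm (b l))\<^sup>2"
      by (metis Re_complex_of_real complex_norm_square)
    ultimately show "Re (b l * cnj (b k)) * expectation (\<lambda>\<omega>. Y l \<omega> * Y k \<omega>) =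
        (if k = l then (norm (b l))\<^sup>2 * expectation (\<lambda>\<omega>. Y l \<omega> * Y l \<omega>) else 0)"
      using ortho by auto
  qed
  also have "\<dots> = (\<Sum>l\<in>V. (norm (b l))\<^sup>2 * expectation (\<lambda>\<omega>. Y l \<omega> * Y l \<omega>))"
    by (simp add: V)
  also have "\<dots> \<le> (\<Sum>l\<in>V. (norm (b l))\<^sup>2)"
    using le by (intro sum_mono mult_left_le) auto
  finally show "expectation (\<lambda>\<omega>. (norm (\<Sum>l\<in>V. of_real (Y l \<omega>) * b l))\<^sup>2) \<le> (\<Sum>l\<in>V. (norm (b l))\<^sup>2)" .
qed

text \<open>The index \<open>i\<close> occurs only once, so independence splits off a factor of mean
  0; the other three indices may coincide.\<close>

lemma expectation_four_product_zero:
  fixes Z :: "'i \<Rightarrow> 'a \<Rightarrow> real"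
  assumes indep: "indep_vars (\<lambda>_. borel) Z UNIV"
    and bound: "\<And>m \<omega>. \<bar>Z m \<omega>\<bar> \<le> 1"
    and mean: "\<And>m. expectation (Z m) = 0"
    and i: "i \<notin> {j, k, l}"
  shows "expectation (\<lambda>\<omega>. Z i \<omega> * Z j \<omega> * Z k \<omega> * Z l \<omega>) = 0"
proof -
  define I where "I = {i, j, k, l}"
  \<comment> \<open>\<open>F r\<close> raises its argument to the number of occurrences of
    \<open>r\<close> among the four indices, so the product runs over distinct indices and
    independence applies.\<close>
  define F where "F r y = (if r = i then y else 1) * (if r = j then y else 1) *
    (if r = k then y else 1) * (if r = l then y else 1)" for r and y :: real
  have [measurable]: "F r \<in> borel_measurable borel" for r
    unfolding F_def by measurable
  have [measurable]: "Z m \<in> borel_measurable M" for m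
    using indep unfolding indep_vars_def by auto
  have le: "\<bar>F r (Z r \<omega>)\<bar> \<le> 1" for r \<omega>
  proof -
    have "\<bar>if P then Z r \<omega> else 1\<bar> \<le> 1" for P
      using bound by simp
    then show ?thesis
      unfolding F_def abs_mult by (intro mult_le_one mult_nonneg_nonneg abs_ge_zero)
  qed
  have "Z i \<omega> * Z j \<omega> * Z k \<omega> * Z l \<omega> = (\<Prod>r\<in>I. F r (Z r \<omega>))" for \<omega>
    by (simp add: F_def prod.distrib I_def del: insert_iff)
       (simp add: prod.delta')
  then have "expectation (\<lambda>\<omega>. Z i \<omega> * Z j \<omega> * Z k \<omega> * Z l \<omega>) =
      expectation (\<lambda>\<omega>. \<Prod>r\<in>I. F r (Z r \<omega>))"
    by simp
  also have "\<dots> = (\<Prod>r\<in>I. expectation (\<lambda>\<omega>. F r (Z r \<omega>)))"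
  proof (rule indep_vars_lebesgue_integral)
    show "indep_vars (\<lambda>_. borel) (\<lambda>r \<omega>. F r (Z r \<omega>)) I"
      by (rule indep_vars_compose2[OF indep_vars_subset[OF indep]]) auto
    show "integrable M (\<lambda>\<omega>. F r (Z r \<omega>))" for r
      by (rule integrable_const_bound[where B = 1]) (use le in auto)
  qed (simp add: I_def)
  also have "\<dots> = 0"
  proof (rule prod_zero)
    have "F i y = y" for y
      using i by (simp add: F_def)
    then show "\<exists>r\<in>I. expectation (\<lambda>\<omega>. F r (Z r \<omega>)) = 0"
      using mean by (auto simp: I_def)
  qed (simp add: I_def)
  finally show ?thesis .
qed

text \<open>For \<open>h \<noteq> 0\<close> the products of weights at distance \<open>h\<close> are
  orthogonal, so each of the \<open>4 * N\<close> nonzero lags contributes at most the sum of fourth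
  powers. At lag 0 nothing cancels and Cauchy-Schwarz costs a factor \<open>2 * N + 1\<close>.
  Treating every lag like lag 0 would give a factor of quadratic order in \<open>N\<close>.\<close>

lemma nn_integral_corr_energy_le:
  fixes Z :: "int \<Rightarrow> 'a \<Rightarrow> real" and c :: "int \<Rightarrow> complex"
  assumes indep: "indep_vars (\<lambda>_. borel) Z UNIV"
    and bound: "\<And>m \<omega>. \<bar>Z m \<omega>\<bar> \<le> 1"
    and mean: "\<And>m. expectation (Z m) = 0"
    and c: "\<And>m. m \<notin> {- int N..int N} \<Longrightarrow> c m = 0"
  shows "(\<integral>\<^sup>+\<omega>. corr_energy N (\<lambda>m. of_real (Z m \<omega>) * c m) \<partial>M) \<le>
    ennreal ((6 * real N + 1) * (\<Sum>m\<in>{- int N..int N}. norm (c m) ^ 4))"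
proof -
  define V where "V = {- int N..int N}"
  define H where "H = {- 2 * int N..2 * int N}"
  define Q where "Q h \<omega> = (norm (\<Sum>l\<in>V. of_real (Z (l + h) \<omega>) * c (l + h) * cnj (of_real (Z l \<omega>) * c l)))\<^sup>2"
    for h \<omega>
  define E where "E = (\<Sum>m\<in>V. norm (c m) ^ 4)"
  have [measurable]: "Z m \<in> borel_measurable M" for m
    using indep unfolding indep_vars_def by auto
  have "0 \<le> E"
    by (simp add: E_def sum_nonneg)
  have Q_eq: "Q h \<omega> = (norm (\<Sum>l\<in>V. of_real (Z (l + h) \<omega> * Z l \<omega>) * (c (l + h) * cnj (c l))))\<^sup>2" for h \<omega>
    by (simp add: Q_def mult_ac)
  have prod_le: "\<bar>Z i \<omega> * Z j \<omega> * (Z k \<omega> * Z l \<omega>)\<bar> \<le> 1" for i j k l \<omega>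
    using bound by (auto simp: abs_mult intro!: mult_le_one)
  have prod_int: "integrable M (\<lambda>\<omega>. Z i \<omega> * Z j \<omega> * (Z k \<omega> * Z l \<omega>))" for i j k l
    by (rule integrable_const_bound[where B = 1]) (use prod_le in auto)
  have shift_le: "(\<Sum>l\<in>V. norm (c (l + h)) ^ 4) \<le> E" for h
  proof -
    have "(\<Sum>l\<in>V. norm (c (l + h)) ^ 4) = (\<Sum>m\<in>(\<lambda>l. l + h) ` V. norm (c m) ^ 4)"
      by (subst sum.reindex) (auto simp: inj_on_def)
    also have "\<dots> = (\<Sum>m\<in>(\<lambda>l. l + h) ` V \<inter> V. norm (c m) ^ 4)"
      using c by (intro sum.mono_neutral_right) (auto simp: V_def)
    also have "\<dots> \<le> E"
      unfolding E_def by (intro sum_mono2) (auto simp: V_def)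
    finally show ?thesis .
  qed
  have off: "(\<integral>\<^sup>+\<omega>. Q h \<omega> \<partial>M) \<le> ennreal E" if h: "h \<noteq> 0" for h
  proof -
    \<comment> \<open>One index is always unmatched: \<open>l\<close>, unless
      \<open>l = k + h\<close>, and then \<open>k\<close>, since \<open>l + h = k + 2 * h\<close>
      differs from it.\<close>
    have ortho: "expectation (\<lambda>\<omega>. Z (l + h) \<omega> * Z l \<omega> * (Z (k + h) \<omega> * Z k \<omega>)) = 0" if "l \<noteq> k" for l k
    proof (cases "l = k + h")
      case False
      have "expectation (\<lambda>\<omega>. Z l \<omega> * Z (l + h) \<omega> * Z (k + h) \<omega> * Z k \<omega>) = 0"
        using that h False by (intro expectation_four_product_zero[OF indep bound mean]) auto
      then show ?thesis
        by (simp add: mult_ac)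
    next
      case True
      have "expectation (\<lambda>\<omega>. Z k \<omega> * Z (l + h) \<omega> * Z l \<omega> * Z (k + h) \<omega>) = 0"
        using that h True by (intro expectation_four_product_zero[OF indep bound mean]) auto
      then show ?thesis
        by (simp add: mult_ac)
    qed
    have diag: "expectation (\<lambda>\<omega>. Z (l + h) \<omega> * Z l \<omega> * (Z (l + h) \<omega> * Z l \<omega>)) \<le> 1" for l
      using integral_mono[OF prod_int[of "l + h" l "l + h" l] integrable_const[of 1]] prod_le
      by (auto simp: prob_space abs_le_iff)
    have fin: "finite V"
      by (simp add: V_def)
    have int: "integrable M (Q h)"
      unfolding Q_eq
      by (rule expectation_norm_square_orthogonal(1)[OF prod_int ortho diag fin])
    have "expectation (Q h) \<le> (\<Sum>l\<in>V. (norm (c (l + h) * cnj (c l)))\<^sup>2)"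
      unfolding Q_eq
      by (rule expectation_norm_square_orthogonal(2)[OF prod_int ortho diag fin])
    also have "\<dots> \<le> (\<Sum>l\<in>V. norm (c (l + h)) ^ 4 / 2 + norm (c l) ^ 4 / 2)"
    proof (rule sum_mono)
      fix l
      \<comment> \<open>The product of squares is split by the arithmetic-geometric mean inequality,
        after which each half sums to at most \<open>E / 2\<close>.\<close>
      have "0 \<le> ((norm (c (l + h)))\<^sup>2 - (norm (c l))\<^sup>2)\<^sup>2"
        by simp
      then show "(norm (c (l + h) * cnj (c l)))\<^sup>2 \<le> norm (c (l + h)) ^ 4 / 2 + norm (c l) ^ 4 / 2"
        by (simp add: norm_mult power2_diff power_mult_distrib flip: power_mult)
    qed
    also have "\<dots> \<le> E"
      using shift_le[of h] by (simp add: sum.distrib E_def flip: sum_divide_distrib)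
    finally show ?thesis
      using int by (subst nn_integral_eq_integral) (auto simp: Q_def intro: ennreal_leI)
  qed
  have diag: "Q 0 \<omega> \<le> (2 * real N + 1) * E" for \<omega>
  proof -
    have "norm (\<Sum>l\<in>V. of_real (Z (l + 0) \<omega> * Z l \<omega>) * (c (l + 0) * cnj (c l))) \<le>
        (\<Sum>l\<in>V. (norm (c l))\<^sup>2)"
    proof (rule order_trans[OF norm_sum sum_mono])
      fix l
      have "\<bar>Z l \<omega> * Z l \<omega>\<bar> \<le> 1"
        using mult_le_one[of "\<bar>Z l \<omega>\<bar>" "\<bar>Z l \<omega>\<bar>"] bound[of l \<omega>] by (simp add: abs_mult)
      then have "\<bar>Z l \<omega> * Z l \<omega>\<bar> * (norm (c l))\<^sup>2 \<le> 1 * (norm (c l))\<^sup>2"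
        by (intro mult_right_mono) auto
      then show "norm (of_real (Z (l + 0) \<omega> * Z l \<omega>) * (c (l + 0) * cnj (c l))) \<le> (norm (c l))\<^sup>2"
        by (simp add: norm_mult power2_eq_square)
    qed
    then have "Q 0 \<omega> \<le> (\<Sum>l\<in>V. (norm (c l))\<^sup>2)\<^sup>2"
      unfolding Q_eq by (intro power_mono) auto
    also have "\<dots> \<le> (\<Sum>l\<in>V. ((norm (c l))\<^sup>2)\<^sup>2) * real (card V)"
      using Cauchy_Schwarz_ineq_sum[of "\<lambda>l. (norm (c l))\<^sup>2" "\<lambda>_. 1" V] by simp
    also have "\<dots> = (2 * real N + 1) * E"
      by (simp add: E_def V_def mult.commute flip: power_mult)
    finally show ?thesis .
  qed
  have "(\<integral>\<^sup>+\<omega>. corr_energy N (\<lambda>m. of_real (Z m \<omega>) * c m) \<partial>M) = (\<integral>\<^sup>+\<omega>. (\<Sum>h\<in>H. ennreal (Q h \<omega>)) \<partial>M)"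
    by (simp add: corr_energy_def Q_def V_def H_def sum_ennreal)
  also have "\<dots> = (\<Sum>h\<in>H. \<integral>\<^sup>+\<omega>. Q h \<omega> \<partial>M)"
    unfolding Q_eq by (rule nn_integral_sum) measurable
  also have "\<dots> = (\<integral>\<^sup>+\<omega>. Q 0 \<omega> \<partial>M) + (\<Sum>h\<in>H - {0}. \<integral>\<^sup>+\<omega>. Q h \<omega> \<partial>M)"
    by (rule sum.remove) (auto simp: H_def)
  also have "\<dots> \<le> ennreal ((2 * real N + 1) * E) + (\<Sum>h\<in>H - {0}. ennreal E)"
  proof (intro add_mono sum_mono off)
    have "(\<integral>\<^sup>+\<omega>. Q 0 \<omega> \<partial>M) \<le> (\<integral>\<^sup>+\<omega>. ennreal ((2 * real N + 1) * E) \<partial>M)"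
      by (intro nn_integral_mono ennreal_leI diag)
    then show "(\<integral>\<^sup>+\<omega>. Q 0 \<omega> \<partial>M) \<le> ennreal ((2 * real N + 1) * E)"
      by (simp add: emeasure_space_1)
  qed auto
  also have "(\<Sum>h\<in>H - {0}. ennreal E) = ennreal (4 * real N * E)"
  proof -
    have "card (H - {0}) = 4 * N"
      by (subst card_Diff_singleton) (auto simp: H_def)
    then show ?thesis
      using \<open>0 \<le> E\<close> by (simp add: ennreal_mult ennreal_of_nat_eq_real_of_nat)
  qed
  also have "ennreal ((2 * real N + 1) * E) + ennreal (4 * real N * E) = ennreal ((6 * real N + 1) * E)"
    using \<open>0 \<le> E\<close> by (simp flip: ennreal_plus) (simp add: algebra_simps)
  finally show ?thesis
    by (simp add: E_def V_def)
qed

end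

section \<open>Almost sure convergence and interpolation of windows\<close>

text \<open>The expected sum is finite, so almost surely the sum is finite and its terms tend to 0.
  The real sequence \<open>y\<close> is exhibited because the terms are
  \<open>ennreal\<close>-valued while later estimates are over the reals.\<close>

lemma AE_LIMSEQ_zero_if_summable_nn_integral:
  fixes Y :: "nat \<Rightarrow> 'a \<Rightarrow> ennreal"
  assumes Y [measurable]: "\<And>k. Y k \<in> borel_measurable M"
    and le: "\<And>k. (\<integral>\<^sup>+\<omega>. Y k \<omega> \<partial>M) \<le> ennreal (b k)"
    and b: "\<And>k. 0 \<le> b k" "summable b"
  shows "AE \<omega> in M. \<exists>y. (\<forall>k. 0 \<le> y k \<and> Y k \<omega> = ennreal (y k)) \<and> y \<longlonglongrightarrow> 0"
proof -
  have "(\<integral>\<^sup>+\<omega>. (\<Sum>k. Y k \<omega>) \<partial>M) = (\<Sum>k. \<integral>\<^sup>+\<omega>. Y k \<omega> \<partial>M)"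
    by (rule nn_integral_suminf) measurable
  also have "\<dots> \<le> (\<Sum>k. ennreal (b k))"
    by (intro suminf_le le) auto
  also have "\<dots> < \<infinity>"
    using b by (subst suminf_ennreal2) auto
  finally have "AE \<omega> in M. (\<Sum>k. Y k \<omega>) \<noteq> \<infinity>"
    by (intro nn_integral_noteq_infinite) auto
  then show ?thesis
  proof eventually_elim
    case (elim \<omega>)
    have fin: "Y k \<omega> < top" for k
    proof -
      have "Y k \<omega> \<le> (\<Sum>k. Y k \<omega>)"
        using sum_le_suminf[of "\<lambda>k. Y k \<omega>" "{k}"] by auto
      then show ?thesis
        using elim by (auto simp: less_top[symmetric] top_unique)
    qed
    then have eq: "Y k \<omega> = ennreal (enn2real (Y k \<omega>))" for k
      by simp
    have "(\<Sum>k. ennreal (enn2real (Y k \<omega>))) \<noteq> top"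
      using elim by (simp flip: eq)
    then have "summable (\<lambda>k. enn2real (Y k \<omega>))"
      by (intro summable_suminf_not_top) auto
    then have "(\<lambda>k. enn2real (Y k \<omega>)) \<longlonglongrightarrow> 0"
      by (rule summable_LIMSEQ_zero)
    then show ?case
      using eq by (intro exI[of _ "\<lambda>k. enn2real (Y k \<omega>)"]) auto
  qed
qed

text \<open>Between \<open>T k\<close> and \<open>T (Suc k)\<close> the integral of \<open>g\<close>
  changes by no more than the integral of \<open>h\<close> grows. Relative to \<open>T k\<close>
  this growth tends to \<open>c * 1 - c = 0\<close>, since consecutive window lengths have ratio
  tending to 1.\<close>

lemma time_avg_upto_interpolate:
  fixes g :: "real \<Rightarrow> complex" and h :: "real \<Rightarrow> real" and T :: "nat \<Rightarrow> real"
  assumes g: "loc_integrable g" and h: "loc_integrable h" and le: "\<And>u. norm (g u) \<le> h u"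
    and h_lim: "(mean_upto h \<longlongrightarrow> c) at_top"
    and T: "\<And>k. 0 < T k" "mono T" "filterlim T at_top sequentially"
      "(\<lambda>k. T (Suc k) / T k) \<longlonglongrightarrow> 1"
    and g_lim: "(\<lambda>k. time_avg_upto g (T k)) \<longlonglongrightarrow> 0"
  shows "(time_avg_upto g \<longlongrightarrow> 0) at_top"
proof -
  define B where "B k = norm (time_avg_upto g (T k)) +
    (mean_upto h (T (Suc k)) * (T (Suc k) / T k) - mean_upto h (T k))" for k
  have h_T: "(\<lambda>k. mean_upto h (T k)) \<longlonglongrightarrow> c"
    using h_lim T(3) by (rule filterlim_compose)
  then have "(\<lambda>k. mean_upto h (T (Suc k))) \<longlonglongrightarrow> c"
    by (rule LIMSEQ_Suc)
  then have "B \<longlonglongrightarrow> norm (0 :: complex) + (c * 1 - c)"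
    unfolding B_def by (intro tendsto_intros h_T T(4) g_lim)
  then have B_lim: "B \<longlonglongrightarrow> 0"
    by simp
  have bound: "norm (time_avg_upto g t) \<le> B k" if t: "T k \<le> t" "t < T (Suc k)" for k t
  proof -
    define I where "I t = {- t / 2..t / 2}" for t :: real
    have int_g: "integrable lborel (\<lambda>u. indicator (I t) u *\<^sub>R g u)" for t
      using loc_integrableD(1)[OF g, of "- t / 2" "t / 2"] by (simp add: set_integrable_def I_def)
    have int_h: "integrable lborel (\<lambda>u. indicator (I t) u *\<^sub>R h u)" for t
      using loc_integrableD(1)[OF h, of "- t / 2" "t / 2"] by (simp add: set_integrable_def I_def)
    have avg_g: "(LBINT u:I t. g u) = t * time_avg_upto g t" if "0 < t" for t
      using that by (simp add: time_avg_upto_def I_def)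
    have avg_h: "(LBINT u:I t. h u) = t * mean_upto h t" if "0 < t" for t
      using that by (simp add: mean_upto_def I_def)
    have t_pos: "0 < t"
      using t T(1)[of k] by simp
    have "norm ((LBINT u:I t. g u) - (LBINT u:I (T k). g u)) =
        norm (\<integral>u. indicator (I t) u *\<^sub>R g u - indicator (I (T k)) u *\<^sub>R g u \<partial>lborel)"
      unfolding set_lebesgue_integral_def
      by (subst Bochner_Integration.integral_diff[OF int_g int_g]) simp
    also have "\<dots> \<le> (\<integral>u. indicator (I (T (Suc k))) u *\<^sub>R h u - indicator (I (T k)) u *\<^sub>R h u \<partial>lborel)"
    proof (rule Bochner_Integration.integral_norm_bound_integral)
      fix u
      have "0 \<le> h u"
        using le[of u] norm_ge_zero order_trans by blast
      then show "norm (indicator (I t) u *\<^sub>R g u - indicator (I (T k)) u *\<^sub>R g u)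
          \<le> indicator (I (T (Suc k))) u *\<^sub>R h u - indicator (I (T k)) u *\<^sub>R h u"
        using t le[of u] by (auto simp: indicator_def I_def)
    qed (intro Bochner_Integration.integrable_diff int_g int_h)+
    also have "\<dots> = (LBINT u:I (T (Suc k)). h u) - (LBINT u:I (T k). h u)"
      unfolding set_lebesgue_integral_def
      by (rule Bochner_Integration.integral_diff[OF int_h int_h])
    also have "\<dots> = T (Suc k) * mean_upto h (T (Suc k)) - T k * mean_upto h (T k)"
      by (simp add: avg_h T(1))
    finally have diff: "norm ((LBINT u:I t. g u) - (LBINT u:I (T k). g u)) \<le> \<dots>" .
    have "T k * norm (time_avg_upto g t) \<le> t * norm (time_avg_upto g t)"
      using t by (intro mult_right_mono) auto
    also have "\<dots> = norm (LBINT u:I t. g u)"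
      using t_pos by (simp add: avg_g norm_mult)
    also have "\<dots> \<le> norm (LBINT u:I (T k). g u) + norm ((LBINT u:I t. g u) - (LBINT u:I (T k). g u))"
      using norm_triangle_ineq[of "LBINT u:I (T k). g u" "(LBINT u:I t. g u) - (LBINT u:I (T k). g u)"]
      by simp
    also have "\<dots> \<le> T k * norm (time_avg_upto g (T k)) +
        (T (Suc k) * mean_upto h (T (Suc k)) - T k * mean_upto h (T k))"
      using diff T(1)[of k] by (simp add: avg_g norm_mult)
    also have "\<dots> = T k * B k"
      using T(1)[of k] by (simp add: B_def field_simps)
    finally show ?thesis
      using T(1)[of k] by simp
  qed
  show ?thesis
  proof (rule tendstoI)
    fix e :: real assume "0 < e"
    then obtain k0 where k0: "\<And>k. k \<ge> k0 \<Longrightarrow> B k < e"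
      using order_tendstoD(2)[OF B_lim] unfolding eventually_sequentially by blast
    have "dist (time_avg_upto g t) 0 < e" if t: "T k0 \<le> t" for t
    proof -
      have "\<exists>j. t < T j"
        using T(3) unfolding filterlim_at_top_dense eventually_sequentially by blast
      \<comment> \<open>The first window longer than \<open>t\<close> has a predecessor of index at
        least \<open>k0\<close>, because \<open>T k0 \<le> t\<close>; these two windows enclose
        \<open>t\<close>.\<close>
      define j where "j = (LEAST j. t < T j)"
      have j: "t < T j"
        unfolding j_def by (rule LeastI_ex) fact
      have min: "T i \<le> t" if "i < j" for i
        using not_less_Least[of i "\<lambda>j. t < T j"] that unfolding j_def by simp
      have "k0 < j"
      proof (rule ccontr)
        assume "\<not> k0 < j"
        then have "T j \<le> T k0"
          using T(2) by (simp add: mono_def)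
        then show False
          using j t by simp
      qed
      then obtain k where k: "j = Suc k" "k0 \<le> k"
        by (metis less_Suc_eq_le less_imp_Suc_add add_Suc_right le_add1)
      have "norm (time_avg_upto g t) \<le> B k"
        using j min[of k] k by (intro bound) auto
      also have "\<dots> < e"
        using k0 k by simp
      finally show ?thesis
        by simp
    qed
    then show "\<forall>\<^sub>F t in at_top. dist (time_avg_upto g t) 0 < e"
      unfolding eventually_at_top_linorder by blast
  qed
qed

lemma set_integral_window_Icc:
  fixes g :: "real \<Rightarrow> 'a :: {banach, second_countable_topology}"
  assumes "loc_integrable g"
  shows "(LBINT u:window Ts N. g u) =
    (LBINT u:{- ((2 * real N + 1) * Ts) / 2..(2 * real N + 1) * Ts / 2}. g u)"
  unfolding set_lebesgue_integral_def
proof (rule integral_cong_AE)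
  have [measurable]: "g \<in> borel_measurable borel"
    using assms by (rule loc_integrable_measurable)
  show "(\<lambda>u. indicator (window Ts N) u *\<^sub>R g u) \<in> borel_measurable lborel"
    "(\<lambda>u. indicator {- ((2 * real N + 1) * Ts) / 2..(2 * real N + 1) * Ts / 2} u *\<^sub>R g u)
      \<in> borel_measurable lborel"
    by measurable
  show "AE u in lborel. indicator (window Ts N) u *\<^sub>R g u =
      indicator {- ((2 * real N + 1) * Ts) / 2..(2 * real N + 1) * Ts / 2} u *\<^sub>R g u"
    using AE_lborel_singleton[of "(2 * real N + 1) * Ts / 2"]
    by eventually_elim (auto simp: indicator_def field_simps)
qed

lemma cnj_measurable [measurable]: "cnj \<in> borel_measurable borel"
  by (intro borel_measurable_continuous_onI continuous_intros)

text \<open>Beyond \<delta> the ratio \<open>y / \<delta>\<close> exceeds 1, so its cube may be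
  inserted. A fourth-power bound thus controls the first power up to an arbitrarily small additive
  \<delta>.\<close>

lemma le_add_fourth_power:
  fixes y \<delta> :: real
  assumes "0 \<le> y" "0 < \<delta>"
  shows "y \<le> \<delta> + y ^ 4 / \<delta> ^ 3"
proof (cases "y \<le> \<delta>")
  case True
  then show ?thesis
    using assms by (simp add: add_increasing2)
next
  case False
  then have "y * \<delta> ^ 3 \<le> y * y ^ 3"
    using assms by (intro mult_left_mono power_mono) auto
  then have "y \<le> y ^ 4 / \<delta> ^ 3"
    using assms by (simp add: field_simps power4_eq_xxxx power3_eq_cube)
  then show ?thesis
    using assms by simp
qed

section \<open>The noise train\<close>

lemma loc_integrable_shift:
  assumes "loc_integrable g"
  shows "loc_integrable (\<lambda>u. g (u + d))"
  unfolding loc_integrable_def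
proof (intro conjI allI)
  have [measurable]: "g \<in> borel_measurable borel"
    using assms by (rule loc_integrable_measurable)
  show "(\<lambda>u. g (u + d)) \<in> borel_measurable borel"
    by measurable
  fix T
  have "integrable lborel (\<lambda>u. indicator {d - T..d + T} u *\<^sub>R g u)"
    using loc_integrableD(1)[OF assms] by (simp add: set_integrable_def)
  from lborel_integrable_real_affine[OF this, of 1 d]
  have "integrable lborel (\<lambda>u. indicator {d - T..d + T} (d + u) *\<^sub>R g (d + u))"
    by simp
  also have "(\<lambda>u. indicator {d - T..d + T} (d + u) *\<^sub>R g (d + u)) =
      (\<lambda>u. indicator {- T..T} u *\<^sub>R g (u + d))"
    by (auto simp: indicator_def add.commute)
  finally show "set_integrable lborel {- T..T} (\<lambda>u. g (u + d))"
    by (simp add: set_integrable_def)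
qed

lemma loc_integrable_sum:
  "(\<And>i. i \<in> I \<Longrightarrow> loc_integrable (g i)) \<Longrightarrow> loc_integrable (\<lambda>u. \<Sum>i\<in>I. g i u)"
  by (induction I rule: infinite_finite_induct) (auto simp: loc_integrable_const intro!: loc_integrable_add)

lemma nn_integral_block:
  fixes h :: "real \<Rightarrow> real"
  assumes "loc_integrable h" "\<And>u. 0 \<le> h u"
  shows "(\<integral>\<^sup>+s\<in>block Ts. ennreal (h s) \<partial>lborel) = ennreal (LBINT s:block Ts. h s)"
proof -
  have "(\<integral>\<^sup>+s\<in>block Ts. ennreal (h s) \<partial>lborel) = (\<integral>\<^sup>+s. ennreal (indicator (block Ts) s *\<^sub>R h s) \<partial>lborel)"
    by (intro nn_integral_cong) (auto simp: indicator_def)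
  also have "\<dots> = ennreal (LBINT s:block Ts. h s)"
    unfolding set_lebesgue_integral_def
    using loc_integrableD(2)[OF assms(1)] assms(2)
    by (intro nn_integral_eq_integral) (auto simp: set_integrable_def)
  finally show ?thesis .
qed

text \<open>For a fixed phase \<open>s\<close> these are the pulse-weighted samples of
  \<open>f\<close> spaced by \<open>Ts\<close>, cut off outside \<open>{- N..N}\<close> because the
  correlation bounds ask for sequences that vanish there.\<close>

definition block_samples :: "(real \<Rightarrow> complex) \<Rightarrow> real \<Rightarrow> real \<Rightarrow> nat \<Rightarrow> real \<Rightarrow> int \<Rightarrow> complex" where
  "block_samples f Ts \<upsilon> N s m =
     (if m \<in> {- int N..int N} then f (s + of_int m * Ts) * complex_of_real (p_sh \<upsilon> s) else 0)"

lemma block_samples_eq_0: "m \<notin> {- int N..int N} \<Longrightarrow> block_samples f Ts \<upsilon> N s m = 0"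
  by (simp only: block_samples_def if_False)

text \<open>
  Bounds the normalised fourth moment over the window of the modulated block sums. It does not involve
  the frequency, so one null set serves all the uncountably many frequencies.
\<close>

definition block_energy ::
  "(real \<Rightarrow> complex) \<Rightarrow> (int \<Rightarrow> real) \<Rightarrow> real \<Rightarrow> real \<Rightarrow> nat \<Rightarrow> ennreal" where
  "block_energy f z Ts \<upsilon> N = (\<integral>\<^sup>+s\<in>block Ts. ennreal ((4 * real N + 1) / (2 * real N + 1) ^ 4 *
     corr_energy N (\<lambda>m. of_real (z m) * block_samples f Ts \<upsilon> N s m)) \<partial>lborel)"

lemma corr_energy_nonneg: "0 \<le> corr_energy N d"
  by (simp add: corr_energy_def sum_nonneg)

lemma (in prob_space) block_energy_measurable:
  assumes [measurable]: "\<And>m. Z m \<in> borel_measurable M" "f \<in> borel_measurable borel"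
  shows "(\<lambda>\<omega>. block_energy f (\<lambda>m. Z m \<omega>) Ts \<upsilon> N) \<in> borel_measurable M"
proof -
  interpret L: sigma_finite_measure "lborel :: real measure"
    by (rule sigma_finite_lborel)
  show ?thesis
    unfolding block_energy_def corr_energy_def block_samples_def p_sh_def rect_def by measurable
qed

text \<open>Tonelli lets the correlation bound act at each phase \<open>s\<close>; integrating over
  \<open>s\<close> then reassembles the window integral of \<open>norm (f u) ^ 4\<close>. The
  remaining factor of order \<open>1 / N\<close> is not summable over all \<open>N\<close>, but it
  is along squares.\<close>

lemma (in prob_space) nn_integral_block_energy_le:
  fixes Z :: "int \<Rightarrow> 'a \<Rightarrow> real"
  assumes indep: "indep_vars (\<lambda>_. borel) Z UNIV"
    and bound: "\<And>m \<omega>. \<bar>Z m \<omega>\<bar> \<le> 1"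
    and mean: "\<And>m. expectation (Z m) = 0"
    and f: "f \<in> borel_measurable borel" and f4: "loc_integrable (\<lambda>u. norm (f u) ^ 4)"
    and Ts: "0 < Ts"
  shows "(\<integral>\<^sup>+\<omega>. block_energy f (\<lambda>m. Z m \<omega>) Ts \<upsilon> N \<partial>M) \<le>
    ennreal (6 * Ts / (2 * real N + 1) * mean_upto (\<lambda>u. norm (f u) ^ 4) ((2 * real N + 1) * Ts))"
proof -
  define L where "L = 2 * real N + 1"
  define V where "V = {- int N..int N}"
  define q where "q = (4 * real N + 1) / L ^ 4"
  have L: "1 \<le> L"
    by (simp add: L_def)
  have q: "0 \<le> q"
    using L by (simp add: q_def)
  have [measurable]: "Z m \<in> borel_measurable M" for m
    using indep unfolding indep_vars_def by auto
  note [measurable] = f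
  interpret P: pair_sigma_finite M "lborel :: real measure"
    by (intro pair_sigma_finite.intro sigma_finite_lborel sigma_finite_measure_axioms)
  let ?X = "\<lambda>s \<omega>. corr_energy N (\<lambda>m. of_real (Z m \<omega>) * block_samples f Ts \<upsilon> N s m)"
  let ?G = "\<lambda>s. \<Sum>m\<in>V. norm (f (s + of_int m * Ts)) ^ 4"
  have G: "loc_integrable ?G"
    by (intro loc_integrable_sum loc_integrable_shift[OF f4])
  have "(\<integral>\<^sup>+\<omega>. block_energy f (\<lambda>m. Z m \<omega>) Ts \<upsilon> N \<partial>M) =
      (\<integral>\<^sup>+s. (\<integral>\<^sup>+\<omega>. ennreal (q * ?X s \<omega>) * indicator (block Ts) s \<partial>M) \<partial>lborel)"
    unfolding block_energy_def q_def L_def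
    by (intro P.Fubini'[symmetric])
      (unfold corr_energy_def block_samples_def p_sh_def rect_def, measurable)
  also have "\<dots> \<le> (\<integral>\<^sup>+s\<in>block Ts. ennreal (q * (6 * real N + 1) * ?G s) \<partial>lborel)"
  proof (rule nn_integral_mono)
    fix s
    have [measurable]: "?X s \<in> borel_measurable M"
      unfolding corr_energy_def block_samples_def by measurable
    have "(\<integral>\<^sup>+\<omega>. ennreal (q * ?X s \<omega>) * indicator (block Ts) s \<partial>M) =
        ennreal q * (\<integral>\<^sup>+\<omega>. ?X s \<omega> \<partial>M) * indicator (block Ts) s"
      using q corr_energy_nonneg by (simp add: ennreal_mult nn_integral_cmult nn_integral_multc)
    also have "(\<integral>\<^sup>+\<omega>. ?X s \<omega> \<partial>M) \<le>
        ennreal ((6 * real N + 1) * (\<Sum>m\<in>{- int N..int N}. norm (block_samples f Ts \<upsilon> N s m) ^ 4))"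
      by (rule nn_integral_corr_energy_le[OF indep bound mean]) (rule block_samples_eq_0)
    also have "\<dots> \<le> ennreal ((6 * real N + 1) * ?G s)"
      unfolding V_def
      by (intro ennreal_leI mult_left_mono sum_mono)
        (auto simp: block_samples_def p_sh_def rect_def norm_mult)
    finally show "(\<integral>\<^sup>+\<omega>. ennreal (q * ?X s \<omega>) * indicator (block Ts) s \<partial>M) \<le>
        ennreal (q * (6 * real N + 1) * ?G s) * indicator (block Ts) s"
      using q by (simp add: mult_right_mono mult_left_mono ennreal_mult sum_nonneg mult.assoc)
  qed
  also have "\<dots> = ennreal (LBINT s:block Ts. q * (6 * real N + 1) * ?G s)"
    using q by (intro nn_integral_block loc_integrable_cmult G) (simp add: sum_nonneg)
  also have "(LBINT s:block Ts. q * (6 * real N + 1) * ?G s) =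
      q * (6 * real N + 1) * (LBINT s:block Ts. ?G s)"
    by simp
  also have "(LBINT s:block Ts. ?G s) = (\<Sum>m\<in>V. LBINT s:block Ts. norm (f (s + of_int m * Ts)) ^ 4)"
    unfolding set_lebesgue_integral_def scaleR_sum_right
    using loc_integrableD(2)[OF loc_integrable_shift[OF f4]]
    by (intro Bochner_Integration.integral_sum) (simp add: set_integrable_def)
  also have "\<dots> = (LBINT u:window Ts N. norm (f u) ^ 4)"
    unfolding V_def by (rule set_integral_window[OF Ts f4, symmetric])
  also have "\<dots> = L * Ts * mean_upto (\<lambda>u. norm (f u) ^ 4) (L * Ts)"
    using L Ts unfolding set_integral_window_Icc[OF f4] mean_upto_def by (simp add: L_def)
  also have "q * (6 * real N + 1) * (L * Ts * mean_upto (\<lambda>u. norm (f u) ^ 4) (L * Ts)) \<le>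
      6 * Ts / L * mean_upto (\<lambda>u. norm (f u) ^ 4) (L * Ts)"
  proof -
    \<comment> \<open>With \<open>L = 2 * N + 1\<close>, the factors are at most
      \<open>2 * L\<close> and \<open>3 * L\<close>, the source of the constant 6.\<close>
    have "(4 * real N + 1) * (6 * real N + 1) \<le> (2 * L) * (3 * L)"
      by (intro mult_mono) (auto simp: L_def)
    then have "q * (6 * real N + 1) * L \<le> 6 * L ^ 2 / L ^ 4 * L"
      using L unfolding q_def times_divide_eq_left
      by (intro mult_right_mono divide_right_mono) (auto simp: power2_eq_square)
    also have "\<dots> = 6 / L"
      using L by (simp add: field_simps power2_eq_square power4_eq_xxxx)
    finally have "q * (6 * real N + 1) * L * (Ts * mean_upto (\<lambda>u. norm (f u) ^ 4) (L * Ts)) \<le>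
        6 / L * (Ts * mean_upto (\<lambda>u. norm (f u) ^ 4) (L * Ts))"
      using Ts L by (intro mult_right_mono)
        (auto simp: mean_upto_def set_lebesgue_integral_def intro!: mult_nonneg_nonneg divide_nonneg_nonneg)
    then show ?thesis
      by (simp add: mult_ac)
  qed
  finally show ?thesis
    unfolding L_def by (simp add: ennreal_leI)
qed

text \<open>Folding the window onto one block makes the integrand at phase \<open>s\<close> an
  exponential sum, whose fourth power the correlations bound. The right-hand side is therefore free
  of \<alpha>.\<close>

lemma window_integral_le_block_energy:
  fixes f :: "real \<Rightarrow> complex" and z :: "int \<Rightarrow> real"
  assumes \<upsilon>: "0 < \<upsilon>" "\<upsilon> < Ts" and z: "\<And>m. \<bar>z m\<bar> \<le> 1" and f: "loc_integrable f" and \<delta>: "0 < \<delta>"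
  shows "ennreal (norm (LBINT u:window Ts N.
      demodulate (\<lambda>u. f u * complex_of_real (sampler z Ts \<upsilon> u)) \<alpha> u) / (2 * real N + 1)) \<le>
    ennreal (\<delta> * Ts) + ennreal (1 / \<delta> ^ 3) * block_energy f z Ts \<upsilon> N"
proof -
  define L where "L = 2 * real N + 1"
  define V where "V = {- int N..int N}"
  define g where "g = demodulate (\<lambda>u. f u * complex_of_real (sampler z Ts \<upsilon> u)) \<alpha>"
  have L: "1 \<le> L"
    by (simp add: L_def)
  have Ts: "0 < Ts"
    using \<upsilon> by simp
  have [measurable]: "f \<in> borel_measurable borel"
    using f by (rule loc_integrable_measurable)
  have "loc_integrable (\<lambda>u. complex_of_real (sampler z Ts \<upsilon> u) * f u)"
    using sampler_bound[of z, OF z]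
    by (intro loc_integrable_bounded_mult[where B = 1] f) auto
  then have g: "loc_integrable g"
    unfolding g_def by (intro loc_integrable_demodulate) (simp add: mult.commute)
  define G where "G s = (\<Sum>m\<in>V. g (s + of_int m * Ts))" for s
  have G: "loc_integrable G"
    unfolding G_def by (intro loc_integrable_sum loc_integrable_shift g)
  define X where "X s = corr_energy N (\<lambda>m. of_real (z m) * block_samples f Ts \<upsilon> N s m)" for s
  have [measurable]: "X \<in> borel_measurable borel"
    unfolding X_def corr_energy_def block_samples_def p_sh_def rect_def by measurable
  define q where "q = (4 * real N + 1) / L ^ 4"
  have pointwise: "norm (G s) / L \<le> \<delta> + 1 / \<delta> ^ 3 * (q * X s)" if s: "s \<in> block Ts" for s
  proof -
    \<comment> \<open>The demodulation factor separates into a unimodular phase common to all blocks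
      and the exponential \<open>cis (\<theta> * of_int m)\<close> of the sum.\<close>
    define \<theta> where "\<theta> = - 2 * pi * \<alpha> * Ts"
    have "g (s + of_int m * Ts) = cis (- 2 * pi * \<alpha> * s) *
        (of_real (z m) * block_samples f Ts \<upsilon> N s m * cis (\<theta> * of_int m))" if "m \<in> V" for m
    proof -
      have "cis (- 2 * pi * \<alpha> * (s + of_int m * Ts)) = cis (- 2 * pi * \<alpha> * s) * cis (\<theta> * of_int m)"
        by (simp add: cis_mult \<theta>_def algebra_simps)
      then show ?thesis
        using that unfolding g_def demodulate_def sampler_block[OF Ts s]
        by (simp add: block_samples_def V_def)
    qed
    then have "G s = cis (- 2 * pi * \<alpha> * s) *
        (\<Sum>m\<in>V. of_real (z m) * block_samples f Ts \<upsilon> N s m * cis (\<theta> * of_int m))"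
      unfolding G_def sum_distrib_left by (intro sum.cong refl) auto
    then have "norm (G s) ^ 4 \<le> (4 * real N + 1) * X s"
      using exp_sum_le_corr_energy[of N "\<lambda>m. of_real (z m) * block_samples f Ts \<upsilon> N s m" \<theta>]
      by (simp add: norm_mult X_def V_def block_samples_eq_0 del: atLeastAtMost_iff)
    then have "(norm (G s) / L) ^ 4 \<le> q * X s"
      using L by (simp add: q_def power_divide divide_right_mono)
    then have "(norm (G s) / L) ^ 4 / \<delta> ^ 3 \<le> q * X s / \<delta> ^ 3"
      using \<delta> by (intro divide_right_mono) auto
    moreover have "norm (G s) / L \<le> \<delta> + (norm (G s) / L) ^ 4 / \<delta> ^ 3"
      using L \<delta> by (intro le_add_fourth_power) auto
    ultimately show ?thesis
      by simp
  qed
  have "(LBINT u:window Ts N. g u) = (LBINT s:block Ts. G s)"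
    unfolding set_integral_window[OF Ts g] G_def V_def
    unfolding set_lebesgue_integral_def scaleR_sum_right
    using loc_integrableD(2)[OF loc_integrable_shift[OF g]]
    by (intro Bochner_Integration.integral_sum[symmetric]) (simp add: set_integrable_def)
  moreover have "(LBINT s:block Ts. G s) / complex_of_real L =
      (\<integral>s. indicator (block Ts) s *\<^sub>R (G s / of_real L) \<partial>lborel)"
    unfolding set_lebesgue_integral_def
    by (subst integral_divide_zero[symmetric]) (simp add: scaleR_conv_of_real)
  ultimately have "ennreal (norm (LBINT u:window Ts N. g u) / L) =
      ennreal (norm (\<integral>s. indicator (block Ts) s *\<^sub>R (G s / of_real L) \<partial>lborel))"
    using L by (metis abs_of_nonneg norm_divide norm_of_real order_trans zero_le_one)
  also have "\<dots> \<le> (\<integral>\<^sup>+s. ennreal (norm (indicator (block Ts) s *\<^sub>R (G s / of_real L))) \<partial>lborel)"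
    using loc_integrableD(2)[OF loc_integrable_cmult[OF G, of "1 / of_real L"]]
    by (intro integral_norm_bound_ennreal) (simp add: set_integrable_def)
  also have "\<dots> \<le> (\<integral>\<^sup>+s. ennreal \<delta> * indicator (block Ts) s +
      ennreal (1 / \<delta> ^ 3) * (ennreal (q * X s) * indicator (block Ts) s) \<partial>lborel)"
  proof (rule nn_integral_mono)
    fix s
    show "ennreal (norm (indicator (block Ts) s *\<^sub>R (G s / of_real L))) \<le>
      ennreal \<delta> * indicator (block Ts) s + ennreal (1 / \<delta> ^ 3) * (ennreal (q * X s) * indicator (block Ts) s)"
    proof (cases "s \<in> block Ts")
      case True
      have "0 \<le> q * X s"
        using L corr_energy_nonneg by (simp add: q_def X_def)
      then have "ennreal \<delta> + ennreal (1 / \<delta> ^ 3) * ennreal (q * X s) = ennreal (\<delta> + 1 / \<delta> ^ 3 * (q * X s))"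
        using \<delta> by (simp add: ennreal_mult[symmetric] ennreal_plus[symmetric] del: ennreal_plus)
      then show ?thesis
        using True pointwise[OF True] L by (simp add: norm_divide ennreal_leI)
    qed simp
  qed
  also have "\<dots> = (\<integral>\<^sup>+s\<in>block Ts. ennreal \<delta> \<partial>lborel) +
      ennreal (1 / \<delta> ^ 3) * (\<integral>\<^sup>+s\<in>block Ts. ennreal (q * X s) \<partial>lborel)"
    by (simp add: nn_integral_add nn_integral_cmult)
  also have "(\<integral>\<^sup>+s\<in>block Ts. ennreal \<delta> \<partial>lborel) = ennreal (\<delta> * Ts)"
    using \<delta> Ts by (simp add: nn_integral_cmult_indicator ennreal_mult)
  finally show ?thesis
    by (simp add: g_def L_def block_energy_def X_def q_def)
qed

text \<open>Summable expected energies give one null set outside which the energies tend to 0. Off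
  this set the argument is deterministic, so it can be carried out for each \<alpha>
  separately.\<close>

lemma (in prob_space) noise_averages_vanish:
  fixes Z :: "int \<Rightarrow> 'a \<Rightarrow> real" and f :: "real \<Rightarrow> complex"
  assumes indep: "indep_vars (\<lambda>_. borel) Z UNIV"
    and bound: "\<And>m \<omega>. \<bar>Z m \<omega>\<bar> \<le> 1"
    and mean: "\<And>m. expectation (Z m) = 0"
    and \<upsilon>: "0 < \<upsilon>" "\<upsilon> < Ts"
    and f: "loc_integrable f"
    and f2: "loc_integrable (\<lambda>u. (norm (f u))\<^sup>2)" "(mean_upto (\<lambda>u. (norm (f u))\<^sup>2) \<longlongrightarrow> A) at_top"
    and f4: "loc_integrable (\<lambda>u. norm (f u) ^ 4)" "(mean_upto (\<lambda>u. norm (f u) ^ 4) \<longlongrightarrow> B) at_top"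
  shows "AE \<omega> in M. \<forall>\<alpha>. (time_avg_upto
    (demodulate (\<lambda>u. f u * complex_of_real (sampler (\<lambda>m. Z m \<omega>) Ts \<upsilon> u)) \<alpha>) \<longlongrightarrow> 0) at_top"
proof -
  \<comment> \<open>Squares grow fast enough for the sum of \<open>1 / L k\<close> to converge, and
    slowly enough for consecutive windows to have length ratio tending to 1.\<close>
  define N :: "nat \<Rightarrow> nat" where "N k = k\<^sup>2" for k
  define L where "L k = 2 * real (N k) + 1" for k
  define T where "T k = L k * Ts" for k
  have Ts: "0 < Ts"
    using \<upsilon> by simp
  have L: "1 \<le> L k" "0 < L k" for k
    by (simp_all add: L_def)
  have T_pos: "0 < T k" for k
    using L[of k] Ts by (simp add: T_def)
  have T_mono: "mono T"
    using Ts by (auto simp: mono_def T_def L_def N_def intro!: mult_right_mono power_mono)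
  have k_le_L: "real k \<le> L k" for k
    by (cases k) (auto simp: L_def N_def power2_eq_square algebra_simps)
  have T_top: "filterlim T at_top sequentially"
  proof (rule filterlim_at_top_mono)
    show "filterlim (\<lambda>k. Ts * real k) at_top sequentially"
      using Ts by (intro filterlim_tendsto_pos_mult_at_top[OF tendsto_const] filterlim_real_sequentially)
    show "\<forall>\<^sub>F k in sequentially. Ts * real k \<le> T k"
      using k_le_L Ts by (auto simp: T_def mult.commute intro!: always_eventually mult_right_mono)
  qed
  have T_ratio: "(\<lambda>k. T (Suc k) / T k) \<longlonglongrightarrow> 1"
  proof -
    have "(\<lambda>k. T (Suc k) / T k - 1) \<longlonglongrightarrow> 0"
    proof (rule Lim_null_comparison)
      show "(\<lambda>k. 6 * inverse (real (Suc k))) \<longlonglongrightarrow> 0"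
        using tendsto_mult_left[OF LIMSEQ_inverse_real_of_nat, of 6] by simp
      have "norm (T (Suc k) / T k - 1) \<le> 6 * inverse (real (Suc k))" for k
      proof -
        have "T (Suc k) / T k - 1 = (4 * real k + 2) / L k"
        proof -
          have "T (Suc k) / T k = L (Suc k) / L k"
            using Ts by (simp add: T_def)
          moreover have "L (Suc k) = L k + (4 * real k + 2)"
            by (simp add: L_def N_def power2_eq_square algebra_simps)
          ultimately show ?thesis
            using L[of k] by (simp add: add_divide_distrib)
        qed
        moreover have "(4 * real k + 2) * real (Suc k) \<le> 6 * L k"
        proof -
          \<comment> \<open>The difference of the two sides is
            \<open>8 * k\<^sup>2 - 6 * k + 4\<close>, which is this square plus 23/8.\<close>
          have "0 \<le> 8 * (real k - 3 / 8)\<^sup>2"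
            by simp
          then show ?thesis
            by (simp add: L_def N_def power2_eq_square algebra_simps)
        qed
        then have "(4 * real k + 2) / L k \<le> 6 * inverse (real (Suc k))"
          using L[of k] by (simp add: field_simps)
        ultimately show ?thesis
          using L[of k] by simp
      qed
      then show "\<forall>\<^sub>F k in sequentially. norm (T (Suc k) / T k - 1) \<le> 6 * inverse (real (Suc k))"
        by simp
    qed
    from tendsto_add[OF this tendsto_const[of 1]] show ?thesis
      by simp
  qed
  have "Bseq (\<lambda>k. mean_upto (\<lambda>u. norm (f u) ^ 4) (T k))"
    by (rule convergent_imp_Bseq) (use filterlim_compose[OF f4(2) T_top] in \<open>auto simp: convergent_def\<close>)
  then obtain C where C: "0 < C" "\<And>k. norm (mean_upto (\<lambda>u. norm (f u) ^ 4) (T k)) \<le> C"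
    unfolding Bseq_def by blast
  define b where "b k = 6 * Ts / L k * C" for k
  have "summable b"
  proof (rule summable_comparison_test')
    show "summable (\<lambda>k. 6 * Ts * C * inverse (real k ^ 2))"
      by (intro summable_mult inverse_power_summable) simp
    fix k :: nat assume "1 \<le> k"
    then have "1 / L k \<le> inverse (real k ^ 2)"
      using L[of k] by (simp add: L_def N_def field_simps)
    then have "6 * Ts * C * (1 / L k) \<le> 6 * Ts * C * inverse (real k ^ 2)"
      using Ts C by (intro mult_left_mono) auto
    then show "norm (b k) \<le> 6 * Ts * C * inverse (real k ^ 2)"
      using Ts C L[of k] by (simp add: b_def mult_ac)
  qed
  have [measurable]: "Z m \<in> borel_measurable M" for m
    using indep unfolding indep_vars_def by auto
  have f_meas: "f \<in> borel_measurable borel"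
    using f by (rule loc_integrable_measurable)
  have "AE \<omega> in M. \<exists>y. (\<forall>k. 0 \<le> y k \<and> block_energy f (\<lambda>m. Z m \<omega>) Ts \<upsilon> (N k) = ennreal (y k)) \<and>
      y \<longlonglongrightarrow> 0"
  proof (rule AE_LIMSEQ_zero_if_summable_nn_integral)
    show "(\<lambda>\<omega>. block_energy f (\<lambda>m. Z m \<omega>) Ts \<upsilon> (N k)) \<in> borel_measurable M" for k
      by (intro block_energy_measurable f_meas) measurable
    show "0 \<le> b k" for k
      using Ts C L[of k] by (simp add: b_def)
    fix k
    have "6 * Ts / L k * mean_upto (\<lambda>u. norm (f u) ^ 4) (T k) \<le> b k"
      unfolding b_def using C(2)[of k] Ts L[of k] by (intro mult_left_mono) auto
    then show "(\<integral>\<^sup>+\<omega>. block_energy f (\<lambda>m. Z m \<omega>) Ts \<upsilon> (N k) \<partial>M) \<le> ennreal (b k)"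
      using nn_integral_block_energy_le[OF indep bound mean f_meas f4(1) Ts, of \<upsilon> "N k"]
      unfolding T_def L_def by (meson ennreal_leI order_trans)
  qed fact
  then show ?thesis
  proof eventually_elim
    case (elim \<omega>)
    then obtain y where y: "\<And>k. 0 \<le> y k"
      "\<And>k. block_energy f (\<lambda>m. Z m \<omega>) Ts \<upsilon> (N k) = ennreal (y k)" "y \<longlonglongrightarrow> 0"
      by blast
    show ?case
    proof
      fix \<alpha>
      define w where "w u = f u * complex_of_real (sampler (\<lambda>m. Z m \<omega>) Ts \<upsilon> u)" for u
      define g where "g = demodulate w \<alpha>"
      define D where "D k = norm (LBINT u:window Ts (N k). g u) / L k" for k
      have g_le: "norm (g u) \<le> norm (f u)" for u
        using sampler_bound[of "\<lambda>m. Z m \<omega>" Ts \<upsilon> u] bound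
        by (simp add: g_def w_def norm_mult mult_left_le)
      have w_le: "norm (w u) \<le> norm (f u)" for u
        using g_le[of u] by (simp add: g_def)
      have "w \<in> borel_measurable borel"
        unfolding w_def using f_meas by measurable
      then have g: "loc_integrable g"
        unfolding g_def by (intro loc_integrable_demodulate loc_integrable_bound[OF f] w_le)
      have D_le: "D k \<le> \<delta> * Ts + 1 / \<delta> ^ 3 * y k" if "0 < \<delta>" for \<delta> k
      proof -
        have "ennreal (D k) \<le> ennreal (\<delta> * Ts) + ennreal (1 / \<delta> ^ 3) * ennreal (y k)"
          using window_integral_le_block_energy[where z = "\<lambda>m. Z m \<omega>", OF \<upsilon> bound f that, of "N k" \<alpha>]
          unfolding D_def L_def g_def w_def y(2) .
        also have "\<dots> = ennreal (\<delta> * Ts + 1 / \<delta> ^ 3 * y k)"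
          using that Ts y(1)[of k] by (simp add: ennreal_mult[symmetric] ennreal_plus[symmetric] del: ennreal_plus)
        finally show ?thesis
          using that Ts y(1)[of k] by (subst (asm) ennreal_le_iff) auto
      qed
      have "D \<longlonglongrightarrow> 0"
      proof (rule tendstoI)
        fix e :: real assume e: "0 < e"
        \<comment> \<open>The part \<open>\<delta> * Ts\<close> takes \<open>e / 2\<close>; with
          \<delta> fixed, \<open>y k\<close> tending to 0 brings the other part below
          \<open>e / 2\<close>.\<close>
        define \<delta> where "\<delta> = e / (2 * Ts)"
        have \<delta>: "0 < \<delta>" "\<delta> * Ts = e / 2"
          using e Ts by (auto simp: \<delta>_def)
        have "(\<lambda>k. 1 / \<delta> ^ 3 * y k) \<longlonglongrightarrow> 1 / \<delta> ^ 3 * 0"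
          by (intro tendsto_intros y)
        then have "\<forall>\<^sub>F k in sequentially. 1 / \<delta> ^ 3 * y k < e / 2"
          using e by (intro order_tendstoD(2)) auto
        then show "\<forall>\<^sub>F k in sequentially. dist (D k) 0 < e"
        proof eventually_elim
          case (elim k)
          have "0 \<le> D k"
            using L[of k] by (simp add: D_def)
          moreover have "D k < e"
            using D_le[OF \<delta>(1), of k] elim \<delta>(2) by linarith
          ultimately show ?case
            by simp
        qed
      qed
      then have "(\<lambda>k. D k / Ts) \<longlonglongrightarrow> 0"
        using tendsto_divide_zero by blast
      moreover have "norm (time_avg_upto g (T k)) = D k / Ts" for k
      proof -
        have "(LBINT u:window Ts (N k). g u) = (LBINT u:{- T k / 2..T k / 2}. g u)"
          unfolding T_def L_def by (rule set_integral_window_Icc[OF g])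
        then have "D k / Ts = norm (LBINT u:{- T k / 2..T k / 2}. g u) / T k"
          unfolding D_def by (simp only: T_def divide_divide_eq_left)
        then show ?thesis
          using T_pos[of k] by (simp add: time_avg_upto_def norm_divide)
      qed
      ultimately have avg: "(\<lambda>k. time_avg_upto g (T k)) \<longlonglongrightarrow> 0"
        by (intro tendsto_norm_zero_cancel[of "\<lambda>k. time_avg_upto g (T k)"]) simp
      have "(time_avg_upto g \<longlongrightarrow> 0) at_top"
      proof (rule time_avg_upto_interpolate[OF g _ _ _ T_pos T_mono T_top T_ratio avg])
        \<comment> \<open>The hypotheses give no limit for the mean of \<open>norm (f u)\<close>,
          but they do for that of the larger function
          \<open>1 + (norm (f u))\<^sup>2\<close>.\<close>
        show "loc_integrable (\<lambda>u. 1 + (norm (f u))\<^sup>2)"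
          by (intro loc_integrable_add loc_integrable_const f2)
        show "norm (g u) \<le> 1 + (norm (f u))\<^sup>2" for u
        proof -
          have "0 \<le> (norm (f u) - 1 / 2)\<^sup>2"
            by simp
          then have "norm (f u) \<le> 1 + (norm (f u))\<^sup>2"
            by (simp add: power2_eq_square algebra_simps)
          then show ?thesis
            using g_le[of u] by simp
        qed
        show "(mean_upto (\<lambda>u. 1 + (norm (f u))\<^sup>2) \<longlongrightarrow> 1 + A) at_top"
        proof (rule Lim_transform_eventually)
          show "((\<lambda>t. 1 + mean_upto (\<lambda>u. (norm (f u))\<^sup>2) t) \<longlongrightarrow> 1 + A) at_top"
            by (intro tendsto_intros f2)
          show "\<forall>\<^sub>F t in at_top. 1 + mean_upto (\<lambda>u. (norm (f u))\<^sup>2) t = mean_upto (\<lambda>u. 1 + (norm (f u))\<^sup>2) t"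
            using eventually_gt_at_top[of 0]
            by eventually_elim (simp add: mean_upto_add loc_integrable_const f2 mean_upto_const)
        qed
      qed
      then show "(time_avg_upto (demodulate (\<lambda>u. f u * complex_of_real (sampler (\<lambda>m. Z m \<omega>) Ts \<upsilon> u)) \<alpha>)
          \<longlongrightarrow> 0) at_top"
        unfolding g_def w_def .
    qed
  qed
qed

section \<open>Time averages of real lag products and the moments of the sampled signals\<close>

lemma cyclostationary_real_lag_product:
  assumes x: "cyclostationary x" and n: "1 \<le> n" "q \<le> n"
    and h: "lag_product n q (delayed x) \<tau> = (\<lambda>t. complex_of_real (h t))"
  shows "loc_integrable h" "\<exists>c. (mean_upto h \<longlongrightarrow> c) at_top"
proof -
  have ext: "sine_extractable (\<lambda>t. complex_of_real (h t))"
    using x n h unfolding cyclostationary_def by metis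
  have "(\<lambda>t. complex_of_real (h t)) \<in> borel_measurable borel"
    using x lag_product_measurable[of x n q \<tau>] h unfolding cyclostationary_def by simp
  then have "(\<lambda>t. Re (complex_of_real (h t))) \<in> borel_measurable borel"
    by measurable
  then have "h \<in> borel_measurable borel"
    by simp
  moreover have "set_integrable lborel {- T..T} h" for T
  proof -
    have "integrable lborel (\<lambda>t. indicator {- T..T} t *\<^sub>R complex_of_real (h t))"
      using ext unfolding sine_extractable_def set_integrable_def by blast
    also have "(\<lambda>t. indicator {- T..T} t *\<^sub>R complex_of_real (h t)) =
        (\<lambda>t. complex_of_real (indicator {- T..T} t *\<^sub>R h t))"
      by (simp add: fun_eq_iff scaleR_conv_of_real)
    finally show ?thesis
      unfolding set_integrable_def complex_of_real_integrable_eq .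
  qed
  ultimately show "loc_integrable h"
    by (simp add: loc_integrable_def)
  \<comment> \<open>A plain mean is the coefficient at frequency 0.\<close>
  obtain c where c: "(time_avg_upto (demodulate (\<lambda>t. complex_of_real (h t)) 0) \<longlongrightarrow> c) at_top"
    using ext unfolding sine_extractable_def by blast
  have "Re (time_avg_upto (demodulate (\<lambda>t. complex_of_real (h t)) 0) T) = mean_upto h T" for T
    by (simp add: time_avg_upto_def demodulate_def[abs_def] mean_upto_def set_integral_complex_of_real
        flip: of_real_divide)
  then have "(mean_upto h \<longlongrightarrow> Re c) at_top"
    using tendsto_Re[OF c] by simp
  then show "\<exists>c. (mean_upto h \<longlongrightarrow> c) at_top" ..
qed

text \<open>Besides the equality, the existence of all time averages and convergence of both series
  at the same \<open>t\<close> are recorded, so the default 0 of \<open>E_hat\<close> is used on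
  both sides or on neither. One null set serves every \<open>t\<close>.\<close>

theorem lemma3p2:
  fixes x :: "real \<Rightarrow> complex"
    and \<tau> :: "nat \<Rightarrow> real"
    and n q :: nat
    and Ts \<upsilon> \<gamma> :: real
    and M :: "'w measure"
    and a :: "int \<Rightarrow> 'w \<Rightarrow> real"
  assumes "cyclostationary x"
    and "1 \<le> n" and "q \<le> n"
    and "0 < \<upsilon>" and "\<upsilon> < Ts"
    and "0 < \<gamma>" and "\<gamma> \<le> 1"
    and "prob_space M"
    and "iid_bernoulli M \<gamma> a"
  shows "sine_extractable (x_lag_sh x Ts \<upsilon> n q \<tau>) \<and>
    (AE \<omega> in M.
       sine_extractable (x_lag_ncs x (\<lambda>m. a m \<omega>) Ts \<upsilon> n q \<tau>) \<and>
       (\<forall>t. (extraction_converges (x_lag_ncs x (\<lambda>m. a m \<omega>) Ts \<upsilon> n q \<tau>) t \<longleftrightarrow>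
              extraction_converges (x_lag_sh x Ts \<upsilon> n q \<tau>) t) \<and>
            R_ncs x (\<lambda>m. a m \<omega>) Ts \<upsilon> n q \<tau> t =
              complex_of_real \<gamma> * R_sh x Ts \<upsilon> n q \<tau> t))"
proof -
  interpret prob_space M by fact
  have Ts: "0 < Ts"
    using assms(4,5) by simp
  define f where "f = lag_product n q (delayed x) \<tau>"
  \<comment> \<open>Multiplication by \<open>cos (2 * pi * t / Ts)\<close> shifts frequencies by
    \<open>1 / Ts\<close> both ways, so the cycle frequencies are closed up under these shifts; only
    integer multiples occur, which keeps \<open>K\<close> countable.\<close>
  define K where "K = (\<Union>k::int. (\<lambda>\<beta>. \<beta> + of_int k / Ts) ` cycle_freqs f)"
  have f_meas: "f \<in> borel_measurable borel"
    using assms(1) unfolding f_def cyclostationary_def by (intro lag_product_measurable) simp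
  have f_ext: "sine_extractable f"
    using assms(1-3) unfolding f_def cyclostationary_def by blast
  then have "countable K"
    unfolding K_def sine_extractable_def by auto
  have "cycle_freqs f \<subseteq> K"
    unfolding K_def by (auto intro!: exI[of _ 0])
  then have f: "has_sine_coeffs K f"
    by (intro sine_extractable_imp_has_sine_coeffs f_ext f_meas)
  then have f_loc: "loc_integrable f"
    by (simp add: has_sine_coeffs_def)
  have K: "\<alpha> + 1 / Ts \<in> K \<and> \<alpha> - 1 / Ts \<in> K" if \<alpha>: "\<alpha> \<in> K" for \<alpha>
  proof -
    obtain k :: int and \<beta> where "\<beta> \<in> cycle_freqs f" "\<alpha> = \<beta> + of_int k / Ts"
      using \<alpha> unfolding K_def by auto
    then have "\<alpha> + 1 / Ts = \<beta> + of_int (k + 1) / Ts" "\<alpha> - 1 / Ts = \<beta> + of_int (k - 1) / Ts"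
      by (auto simp: add_divide_distrib diff_divide_distrib)
    then show ?thesis
      using \<open>\<beta> \<in> cycle_freqs f\<close> unfolding K_def by blast
  qed
  \<comment> \<open>Squaring the modulus twice reaches \<open>norm (f u) ^ 4\<close>: the lag
    product representing the square is the input of the second squaring.\<close>
  obtain \<tau>2 where \<tau>2: "lag_product (2 * n) n (delayed x) \<tau>2 = (\<lambda>u. complex_of_real ((norm (f u))\<^sup>2))"
    using lag_product_norm_square[of n x q \<tau>] unfolding f_def by blast
  obtain \<tau>4 where "lag_product (2 * (2 * n)) (2 * n) (delayed x) \<tau>4 =
      (\<lambda>u. complex_of_real ((norm (complex_of_real ((norm (f u))\<^sup>2)))\<^sup>2))"
    using lag_product_norm_square[of "2 * n" x n \<tau>2] unfolding \<tau>2 by blast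
  also have "\<dots> = (\<lambda>u. complex_of_real (norm (f u) ^ 4))"
    by (simp only: norm_of_real abs_power2 flip: power_mult) simp
  finally have \<tau>4: "lag_product (2 * (2 * n)) (2 * n) (delayed x) \<tau>4 =
    (\<lambda>u. complex_of_real (norm (f u) ^ 4))" .
  have f2: "loc_integrable (\<lambda>u. (norm (f u))\<^sup>2)"
    and f4: "loc_integrable (\<lambda>u. norm (f u) ^ 4)"
    using assms(2) by (auto intro!: cyclostationary_real_lag_product(1)[OF assms(1) _ _ \<tau>2]
        cyclostationary_real_lag_product(1)[OF assms(1) _ _ \<tau>4])
  obtain A where A: "(mean_upto (\<lambda>u. (norm (f u))\<^sup>2) \<longlongrightarrow> A) at_top"
    using cyclostationary_real_lag_product(2)[OF assms(1) _ _ \<tau>2] assms(2) by auto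
  obtain B where B: "(mean_upto (\<lambda>u. norm (f u) ^ 4) \<longlongrightarrow> B) at_top"
    using cyclostationary_real_lag_product(2)[OF assms(1) _ _ \<tau>4] assms(2) by auto
  define S where "S b u = f u * complex_of_real (sampler b Ts \<upsilon> u)" for b u
  have sh: "x_lag_sh x Ts \<upsilon> n q \<tau> = S (\<lambda>_. 1)"
    using x_lag_ncs_eq[OF assms(4,5,2), of "\<lambda>_. 1"] by (simp add: x_lag_sh_eq_ncs S_def[abs_def] f_def)
  have S_sh: "has_sine_coeffs K (S (\<lambda>_. 1))"
    unfolding S_def by (rule has_sine_coeffs_pulse_train[OF assms(4,5) f f2 A K])

  \<comment> \<open>Testing \<open>a m \<omega> = 1\<close> keeps \<open>Z\<close> bounded by 1 at
    every \<omega>, as the noise bounds require, whereas \<open>a m\<close> is known to take only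
    the values 0 and 1 almost surely. Where it does,
    \<open>Z m \<omega> = a m \<omega> - \<gamma>\<close>.\<close>
  define Z where "Z m \<omega> = (if a m \<omega> = 1 then 1 else 0) - \<gamma>" for m \<omega>
  have indep_a: "indep_vars (\<lambda>_. borel) a UNIV"
    and a1: "prob {\<omega> \<in> space M. a m \<omega> = 1} = \<gamma>"
    and a0: "prob {\<omega> \<in> space M. a m \<omega> = 0} = 1 - \<gamma>" for m
    using assms(9) unfolding iid_bernoulli_def by auto
  have [measurable]: "a m \<in> borel_measurable M" for m
    using indep_a unfolding indep_vars_def by auto
  have indep: "indep_vars (\<lambda>_. borel) Z UNIV"
    unfolding Z_def[abs_def]
    by (rule indep_vars_compose2[OF indep_a, of "\<lambda>_ y. (if y = 1 then 1 else 0) - \<gamma>"]) measurable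
  have bound: "\<bar>Z m \<omega>\<bar> \<le> 1" for m \<omega>
    using assms(6,7) by (simp add: Z_def)
  have mean: "expectation (Z m) = 0" for m
  proof -
    have "expectation (Z m) = expectation (\<lambda>\<omega>. indicator {\<omega> \<in> space M. a m \<omega> = 1} \<omega> - \<gamma>)"
      by (intro Bochner_Integration.integral_cong) (auto simp: Z_def indicator_def)
    also have "\<dots> = prob {\<omega> \<in> space M. a m \<omega> = 1} - \<gamma>"
      by (subst Bochner_Integration.integral_diff)
        (auto simp: prob_space emeasure_eq_measure intro!: integrable_real_indicator)
    finally show ?thesis
      by (simp add: a1)
  qed
  have a01: "AE \<omega> in M. \<forall>m. a m \<omega> = 0 \<or> a m \<omega> = 1"
    unfolding AE_all_countable
  proof
    fix m
    have "prob ({\<omega> \<in> space M. a m \<omega> = 0} \<union> {\<omega> \<in> space M. a m \<omega> = 1}) = (1 - \<gamma>) + \<gamma>"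
      by (subst finite_measure_Union) (auto simp: a0 a1)
    then have "AE \<omega> in M. \<omega> \<in> {\<omega> \<in> space M. a m \<omega> = 0} \<union> {\<omega> \<in> space M. a m \<omega> = 1}"
      by (intro AE_prob_1) simp
    then show "AE \<omega> in M. a m \<omega> = 0 \<or> a m \<omega> = 1"
      by eventually_elim auto
  qed
  have "AE \<omega> in M. \<forall>\<alpha>. (time_avg_upto (demodulate (S (\<lambda>m. Z m \<omega>)) \<alpha>) \<longlongrightarrow> 0) at_top"
    unfolding S_def[abs_def]
    by (rule noise_averages_vanish[OF indep bound mean assms(4,5) f_loc f2 A f4 B])
  then have "AE \<omega> in M.
       sine_extractable (x_lag_ncs x (\<lambda>m. a m \<omega>) Ts \<upsilon> n q \<tau>) \<and>
       (\<forall>t. (extraction_converges (x_lag_ncs x (\<lambda>m. a m \<omega>) Ts \<upsilon> n q \<tau>) t \<longleftrightarrow>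
              extraction_converges (x_lag_sh x Ts \<upsilon> n q \<tau>) t) \<and>
            R_ncs x (\<lambda>m. a m \<omega>) Ts \<upsilon> n q \<tau> t =
              complex_of_real \<gamma> * R_sh x Ts \<upsilon> n q \<tau> t)"
    using a01
  proof eventually_elim
    case (elim \<omega>)
    define b where "b m = a m \<omega>" for m
    have b: "b m = 0 \<or> b m = 1" for m
      using elim(2) by (simp add: b_def)
    have Z_eq: "(\<lambda>m. Z m \<omega>) = (\<lambda>m. b m - \<gamma>)"
    proof
      fix m show "Z m \<omega> = b m - \<gamma>"
        using b[of m] by (auto simp: Z_def b_def)
    qed
    have ncs: "x_lag_ncs x (\<lambda>m. a m \<omega>) Ts \<upsilon> n q \<tau> = S b"
      using x_lag_ncs_eq[OF assms(4,5,2) b] by (simp add: S_def[abs_def] f_def b_def[abs_def])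
    have locS: "loc_integrable (S c)" if "\<And>m. \<bar>c m\<bar> \<le> 1" for c
      unfolding S_def
      using loc_integrable_bounded_mult[OF f_loc, of "\<lambda>u. complex_of_real (sampler c Ts \<upsilon> u)" 1]
        sampler_bound[of c, OF that]
      by (simp add: mult.commute)
    have loc_b: "loc_integrable (S b)"
      using b by (intro locS) (metis abs_0 abs_1 order_refl zero_le_one)
    have loc_Z: "loc_integrable (S (\<lambda>m. Z m \<omega>))"
      by (intro locS bound)
    have loc_1: "loc_integrable (S (\<lambda>_. 1))"
      by (intro locS) simp
    \<comment> \<open>The weights \<open>b m\<close> are \<gamma> plus centred noise. The noise
      contributes 0 to every coefficient, so the factor \<gamma> remains.\<close>
    have split: "demodulate (S b) \<alpha> =
        (\<lambda>u. demodulate (S (\<lambda>m. Z m \<omega>)) \<alpha> u + complex_of_real \<gamma> * demodulate (S (\<lambda>_. 1)) \<alpha> u)" for \<alpha>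
      unfolding Z_eq by (simp add: demodulate_def S_def fun_eq_iff algebra_simps flip: sampler_diff)
    have lim: "(time_avg_upto (demodulate (S b) \<alpha>) \<longlongrightarrow> complex_of_real \<gamma> * c) at_top"
      if "(time_avg_upto (demodulate (S (\<lambda>_. 1)) \<alpha>) \<longlongrightarrow> c) at_top" for \<alpha> c
    proof -
      have "time_avg_upto (demodulate (S b) \<alpha>) =
          (\<lambda>T. time_avg_upto (demodulate (S (\<lambda>m. Z m \<omega>)) \<alpha>) T +
            complex_of_real \<gamma> * time_avg_upto (demodulate (S (\<lambda>_. 1)) \<alpha>) T)"
        unfolding split
        by (rule ext) (simp only: time_avg_upto_add[OF loc_integrable_demodulate[OF loc_Z]
              loc_integrable_cmult[OF loc_integrable_demodulate[OF loc_1]]] time_avg_upto_cmult)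
      moreover have "((\<lambda>T. time_avg_upto (demodulate (S (\<lambda>m. Z m \<omega>)) \<alpha>) T +
          complex_of_real \<gamma> * time_avg_upto (demodulate (S (\<lambda>_. 1)) \<alpha>) T) \<longlongrightarrow> 0 + complex_of_real \<gamma> * c) at_top"
        using elim(1) that by (intro tendsto_intros) auto
      ultimately show ?thesis
        by simp
    qed
    have "has_sine_coeffs K (S b)"
      using S_sh loc_b lim unfolding has_sine_coeffs_def by (metis mult_zero_right)
    moreover have "sine_coeff (S b) \<alpha> = complex_of_real \<gamma> * sine_coeff (S (\<lambda>_. 1)) \<alpha>" for \<alpha>
    proof -
      obtain c where "(time_avg_upto (demodulate (S (\<lambda>_. 1)) \<alpha>) \<longlongrightarrow> c) at_top"
        using S_sh unfolding has_sine_coeffs_def by blast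
      then show ?thesis
        using sine_coeffI lim by metis
    qed
    \<comment> \<open>Positivity of \<gamma> makes the scaling factor invertible, so that no cycle
      frequency is lost.\<close>
    moreover have "complex_of_real \<gamma> \<noteq> 0"
      using assms(6) by simp
    ultimately show ?case
      unfolding R_ncs_def R_sh_def ncs sh
      using has_sine_coeffs_imp_extractable \<open>countable K\<close> extraction_converges_scale E_hat_scale by metis
  qed
  moreover have "sine_extractable (x_lag_sh x Ts \<upsilon> n q \<tau>)"
    unfolding sh by (rule has_sine_coeffs_imp_extractable[OF S_sh \<open>countable K\<close>])
  ultimately show ?thesis
    by blast
qed

end
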